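(* Let $H$ be a separable complex Hilbert space, $A$ a strictly positive selfadjoint operator on $H$, and $f:\sigma(A)\to[0,\infty)$ a continuous function. Let $\mathcal{H}=H^1\times H$ and let $\mathbb{A}:\mathrm{dom}(\mathbb{A})\subset\mathcal{H}\to\mathcal{H}$ be the operator $\mathbb{A}(u,v)=(v,-Au-f(A)v)$ defined in the context. Then $\mathbb{A}$ is the infinitesimal generator of a (strongly continuous) contraction semigroup $S(t)=e^{t\mathbb{A}}:\mathcal{H}\to\mathcal{H}$.
   Context: $(H,\langle\cdot,\cdot\rangle,\|\cdot\|)$ is a separable complex Hilbert space and $A:\mathrm{dom}(A)\subset H\to H$ is a strictly positive selfadjoint linear operator (so $\sigma(A)$ is a nonempty closed subset of $(0,\infty)$; $A$ may be bounded or unbounded and $A^{-1}$ is not necessarily compact). $f:\sigma(A)\to[0,\infty)$ is continuous, and $f(A)=\int_{\sigma(A)}f(s)\,dE_A(s)$ is the selfadjoint operator given by the functional calculus, $E_A$ being the spectral measure of $A$. For $r>0$, $H^r=\mathrm{dom}(A^{r/2})$ with norm $\|u\|_r=\|A^{r/2}u\|$. The phase space is $\mathcal{H}=H^1\times H$ with norm $\|(u,v)\|_{\mathcal{H}}^2=\|u\|_1^2+\|v\|^2$. The operator $\mathbb{A}$ is $\mathbb{A}(u,v)=(v,\,-(Au+f(A)v))$ with domain $\mathrm{dom}(\mathbb{A})=\{(u,v)\in\mathcal{H}: v\in H^1,\ Au+f(A)v\in H\}$. Here, when $u\notin\mathrm{dom}(A)$ or $v\notin\mathrm{dom}(f(A))$,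 $Au$ and $f(A)v$ are understood by duality, as the functionals $w\mapsto\langle Aw,u\rangle$ on $\mathrm{dom}(A)$ and $w\mapsto\langle f(A)w,v\rangle$ on $\mathrm{dom}(f(A))$; thus $Au+f(A)v\in H$ means that there is $h\in H$ (then denoted $Au+f(A)v$) with $\langle Aw,u\rangle+\langle f(A)w,v\rangle=\langle w,h\rangle$ for all $w\in\mathrm{dom}(A)\cap\mathrm{dom}(f(A))$. *)

theory Defs
  imports "HOL-Analysis.Analysis"
begin

section \<open>Complex Hilbert spaces\<close>

class complex_vector = real_vector +
  fixes scaleC :: "complex \<Rightarrow> 'a \<Rightarrow> 'a"  (infixr "*\<^sub>C" 75)
  assumes scaleC_of_real: "complex_of_real r *\<^sub>C x = r *\<^sub>R x"
    and scaleC_add_right: "a *\<^sub>C (x + y) = a *\<^sub>C x + a *\<^sub>C y"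
    and scaleC_add_left: "(a + b) *\<^sub>C x = a *\<^sub>C x + b *\<^sub>C x"
    and scaleC_scaleC: "a *\<^sub>C b *\<^sub>C x = (a * b) *\<^sub>C x"

instantiation prod :: (complex_vector, complex_vector) complex_vector
begin

definition scaleC_prod_def: "a *\<^sub>C x = (a *\<^sub>C fst x, a *\<^sub>C snd x)"

instance
  by standard
    (auto simp: scaleC_prod_def scaleC_of_real scaleC_add_right scaleC_add_left scaleC_scaleC
       scaleR_prod_def)

end

text \<open>The inner product is linear in its first and antilinear in its second argument.\<close>

class complex_inner = complex_vector + real_normed_vector +
  fixes cinner :: "'a \<Rightarrow> 'a \<Rightarrow> complex"
  assumes cinner_commute: "cinner x y = cnj (cinner y x)"
    and cinner_add_left: "cinner (x + y) z = cinner x z + cinner y z"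
    and cinner_scaleC_left: "cinner (a *\<^sub>C x) y = a * cinner x y"
    and cinner_ge_zero: "0 \<le> Re (cinner x x)"
    and norm_eq_sqrt_cinner: "norm x = sqrt (Re (cinner x x))"

class chilbert_space = complex_inner + complete_space

section \<open>Partially defined linear operators\<close>

definition clinear_on :: "'x::complex_vector set \<Rightarrow> ('x \<Rightarrow> 'y::complex_vector) \<Rightarrow> bool" where
  "clinear_on X T \<longleftrightarrow>
     0 \<in> X \<and> (\<forall>x\<in>X. \<forall>y\<in>X. x + y \<in> X \<and> T (x + y) = T x + T y) \<and>
     (\<forall>c. \<forall>x\<in>X. c *\<^sub>C x \<in> X \<and> T (c *\<^sub>C x) = c *\<^sub>C T x)"

definition linear_operator :: "('h::complex_vector \<rightharpoonup> 'h) \<Rightarrow> bool" where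
  "linear_operator A \<longleftrightarrow> clinear_on (dom A) (\<lambda>u. the (A u))"

definition is_adjoint_value :: "('h::complex_inner \<rightharpoonup> 'h) \<Rightarrow> 'h \<Rightarrow> 'h \<Rightarrow> bool" where
  "is_adjoint_value A u h \<longleftrightarrow> (\<forall>w\<in>dom A. cinner (the (A w)) u = cinner w h)"

definition adjoint_op :: "('h::complex_inner \<rightharpoonup> 'h) \<Rightarrow> ('h \<rightharpoonup> 'h)" where
  "adjoint_op A u =
     (if \<exists>h. is_adjoint_value A u h then Some (THE h. is_adjoint_value A u h) else None)"

definition selfadjoint :: "('h::complex_inner \<rightharpoonup> 'h) \<Rightarrow> bool" where
  "selfadjoint A \<longleftrightarrow> linear_operator A \<and> closure (dom A) = UNIV \<and> adjoint_op A = A"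

text \<open>Strict positivity is positivity with a positive lower bound, so that \<open>0\<close> is not in
  the spectrum; \<open>\<langle>Au, u\<rangle> > 0\<close> for \<open>u \<noteq> 0\<close> would not be enough.\<close>

definition strictly_positive :: "('h::complex_inner \<rightharpoonup> 'h) \<Rightarrow> bool" where
  "strictly_positive A \<longleftrightarrow>
     (\<exists>c>0. \<forall>u\<in>dom A. c * (norm u)\<^sup>2 \<le> Re (cinner (the (A u)) u))"

definition resolvent_set :: "('h::complex_inner \<rightharpoonup> 'h) \<Rightarrow> complex set" where
  "resolvent_set A =
     {z. bij_betw (\<lambda>u. the (A u) - z *\<^sub>C u) (dom A) UNIV \<and>
         (\<exists>C. \<forall>u\<in>dom A. norm u \<le> C * norm (the (A u) - z *\<^sub>C u))}"

definition spectrum :: "('h::complex_inner \<rightharpoonup> 'h) \<Rightarrow> complex set" where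
  "spectrum A = - resolvent_set A"

text \<open>The spectrum of a selfadjoint operator lies on the real line; here it is regarded as a
  set of reals.\<close>

definition real_spectrum :: "('h::complex_inner \<rightharpoonup> 'h) \<Rightarrow> real set" where
  "real_spectrum A = {s. complex_of_real s \<in> spectrum A}"

section \<open>Spectral measures and the functional calculus\<close>

text \<open>Projection-valued measures on the Borel sets of the real line.\<close>

definition pvm :: "(real set \<Rightarrow> 'h::complex_inner \<Rightarrow> 'h) \<Rightarrow> bool" where
  "pvm E \<longleftrightarrow>
     (\<forall>B\<in>sets borel. clinear_on UNIV (E B) \<and> (\<forall>x. E B (E B x) = E B x) \<and>
        (\<forall>x y. cinner (E B x) y = cinner x (E B y))) \<and>
     E UNIV = id \<and>
     (\<forall>B\<in>sets borel. \<forall>C\<in>sets borel. E (B \<inter> C) = E B \<circ> E C) \<and>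
     (\<forall>B. range B \<subseteq> sets borel \<and> disjoint_family B \<longrightarrow>
        (\<forall>x. (\<lambda>n::nat. E (B n) x) sums E (\<Union>n. B n) x))"

text \<open>The scalar measure \<open>B \<mapsto> \<langle>E(B)x, x\<rangle>\<close>.\<close>

definition scalar_measure :: "(real set \<Rightarrow> 'h::complex_inner \<Rightarrow> 'h) \<Rightarrow> 'h \<Rightarrow> real measure" where
  "scalar_measure E x =
     measure_of UNIV (sets borel) (\<lambda>B. ennreal (Re (cinner (E B x) x)))"

definition simple_spectral_integral ::
  "(real set \<Rightarrow> 'h::complex_inner \<Rightarrow> 'h) \<Rightarrow> (real \<Rightarrow> real) \<Rightarrow> 'h \<Rightarrow> 'h" where
  "simple_spectral_integral E s x = (\<Sum>c\<in>range s. c *\<^sub>R E (s -` {c}) x)"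

text \<open>\<open>y = (\<integral> g dE) x\<close>, as the limit of integrals of simple functions
  that converge to \<open>g\<close> in \<open>L\<^sup>2(\<langle>E(\<cdot>)x, x\<rangle>)\<close>.\<close>

definition is_spectral_integral ::
  "(real set \<Rightarrow> 'h::complex_inner \<Rightarrow> 'h) \<Rightarrow> (real \<Rightarrow> real) \<Rightarrow> 'h \<Rightarrow> 'h \<Rightarrow> bool" where
  "is_spectral_integral E g x y \<longleftrightarrow>
     (\<forall>s :: nat \<Rightarrow> real \<Rightarrow> real.
        (\<forall>n. simple_function borel (s n)) \<and>
        (\<lambda>n. \<integral>\<^sup>+ r. ennreal ((s n r - g r)\<^sup>2) \<partial>scalar_measure E x) \<longlonglongrightarrow> 0 \<longrightarrow>
        (\<lambda>n. simple_spectral_integral E (s n) x) \<longlonglongrightarrow> y)"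

text \<open>For Borel measurable \<open>g\<close>, the operator \<open>\<integral> g dE\<close> with domain
  \<open>{x. \<integral> g\<^sup>2 d\<langle>E(\<cdot>)x, x\<rangle> < \<infinity>}\<close>.\<close>

definition spectral_integral ::
  "(real set \<Rightarrow> 'h::complex_inner \<Rightarrow> 'h) \<Rightarrow> (real \<Rightarrow> real) \<Rightarrow> ('h \<rightharpoonup> 'h)" where
  "spectral_integral E g x =
     (if (\<integral>\<^sup>+ r. ennreal ((g r)\<^sup>2) \<partial>scalar_measure E x) < \<infinity>
      then Some (THE y. is_spectral_integral E g x y) else None)"

text \<open>By the spectral theorem, every selfadjoint \<open>A\<close> has a spectral measure in the following
  sense, and its values on Borel sets are uniquely determined by \<open>A\<close>.\<close>

definition is_spectral_measure_of ::
  "(real set \<Rightarrow> 'h::complex_inner \<Rightarrow> 'h) \<Rightarrow> ('h \<rightharpoonup> 'h) \<Rightarrow> bool" where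
  "is_spectral_measure_of E A \<longleftrightarrow> pvm E \<and> A = spectral_integral E (\<lambda>s. s)"

text \<open>\<open>g(A) = \<integral>\<^bsub>\<sigma>(A)\<^esub> g dE\<close>; only the values of \<open>g\<close> on the spectrum
  matter.\<close>

definition fun_calc ::
  "('h::complex_inner \<rightharpoonup> 'h) \<Rightarrow> (real set \<Rightarrow> 'h \<Rightarrow> 'h) \<Rightarrow> (real \<Rightarrow> real) \<Rightarrow> ('h \<rightharpoonup> 'h)" where
  "fun_calc A E g = spectral_integral E (\<lambda>s. indicator (real_spectrum A) s * g s)"

section \<open>The phase space and the damped operator\<close>

definition frac_power ::
  "('h::complex_inner \<rightharpoonup> 'h) \<Rightarrow> (real set \<Rightarrow> 'h \<Rightarrow> 'h) \<Rightarrow> real \<Rightarrow> ('h \<rightharpoonup> 'h)" where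
  "frac_power A E p = fun_calc A E (\<lambda>s. s powr p)"

definition H_space ::
  "('h::complex_inner \<rightharpoonup> 'h) \<Rightarrow> (real set \<Rightarrow> 'h \<Rightarrow> 'h) \<Rightarrow> real \<Rightarrow> 'h set" where
  "H_space A E r = dom (frac_power A E (r / 2))"

definition H_norm ::
  "('h::complex_inner \<rightharpoonup> 'h) \<Rightarrow> (real set \<Rightarrow> 'h \<Rightarrow> 'h) \<Rightarrow> real \<Rightarrow> 'h \<Rightarrow> real" where
  "H_norm A E r u = norm (the (frac_power A E (r / 2) u))"

definition phase_space ::
  "('h::complex_inner \<rightharpoonup> 'h) \<Rightarrow> (real set \<Rightarrow> 'h \<Rightarrow> 'h) \<Rightarrow> ('h \<times> 'h) set" where
  "phase_space A E = H_space A E 1 \<times> UNIV"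

definition phase_norm ::
  "('h::complex_inner \<rightharpoonup> 'h) \<Rightarrow> (real set \<Rightarrow> 'h \<Rightarrow> 'h) \<Rightarrow> 'h \<times> 'h \<Rightarrow> real" where
  "phase_norm A E z = sqrt ((H_norm A E 1 (fst z))\<^sup>2 + (norm (snd z))\<^sup>2)"

text \<open>\<open>Au + Fv = h\<close> by duality, where \<open>u\<close> need not be in \<open>dom A\<close> nor \<open>v\<close> in \<open>dom F\<close>.\<close>

definition is_dual_sum ::
  "('h::complex_inner \<rightharpoonup> 'h) \<Rightarrow> ('h \<rightharpoonup> 'h) \<Rightarrow> 'h \<Rightarrow> 'h \<Rightarrow> 'h \<Rightarrow> bool" where
  "is_dual_sum A F u v h \<longleftrightarrow>
     (\<forall>w\<in>dom A \<inter> dom F. cinner (the (A w)) u + cinner (the (F w)) v = cinner w h)"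

definition damped_operator ::
  "('h::complex_inner \<rightharpoonup> 'h) \<Rightarrow> (real set \<Rightarrow> 'h \<Rightarrow> 'h) \<Rightarrow> (real \<Rightarrow> real) \<Rightarrow>
     ('h \<times> 'h \<rightharpoonup> 'h \<times> 'h)" where
  "damped_operator A E f = (\<lambda>(u, v).
     if (u, v) \<in> phase_space A E \<and> v \<in> H_space A E 1 \<and>
        (\<exists>h. is_dual_sum A (fun_calc A E f) u v h)
     then Some (v, - (THE h. is_dual_sum A (fun_calc A E f) u v h)) else None)"

section \<open>Contraction semigroups\<close>

text \<open>Here \<open>X\<close> is the underlying set of a complex normed space and \<open>N\<close> its norm, which need
  not be the norm of the ambient type. Only \<open>S t\<close> for \<open>t \<ge> 0\<close> on \<open>X\<close> is relevant.\<close>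

definition contraction_semigroup ::
  "'x::complex_vector set \<Rightarrow> ('x \<Rightarrow> real) \<Rightarrow> (real \<Rightarrow> 'x \<Rightarrow> 'x) \<Rightarrow> bool" where
  "contraction_semigroup X N S \<longleftrightarrow>
     (\<forall>t\<ge>0. S t ` X \<subseteq> X \<and> clinear_on X (S t) \<and> (\<forall>x\<in>X. N (S t x) \<le> N x)) \<and>
     (\<forall>x\<in>X. S 0 x = x) \<and>
     (\<forall>s\<ge>0. \<forall>t\<ge>0. \<forall>x\<in>X. S (s + t) x = S s (S t x)) \<and>
     (\<forall>x\<in>X. ((\<lambda>t. N (S t x - x)) \<longlongrightarrow> 0) (at_right 0))"

definition is_generator ::
  "'x::complex_vector set \<Rightarrow> ('x \<Rightarrow> real) \<Rightarrow> (real \<Rightarrow> 'x \<Rightarrow> 'x) \<Rightarrow> ('x \<rightharpoonup> 'x) \<Rightarrow> bool" where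
  "is_generator X N S B \<longleftrightarrow>
     (\<forall>x y. B x = Some y \<longleftrightarrow>
        x \<in> X \<and> y \<in> X \<and> ((\<lambda>t. N ((1 / t) *\<^sub>R (S t x - x) - y)) \<longlongrightarrow> 0) (at_right 0))"

end

(*
  Put p = sqrt s and q = f(s). The map (u, v) |-> (A^(1/2) u, v) identifies the phase space isometrically
  with H x H and turns the operator into the matrix M = [[0, p], [-p, -q]] of functions of A. For every
  fixed s the real matrices exp(t M(s)) are contractions of R^2, because d/dt |x|^2 = - 2 q x_2^2. Their
  entries are therefore bounded Borel functions, and the bounded functional calculus turns exp(t M) into a
  strongly continuous contraction semigroup T on H x H.

  For the generator let P_n be the spectral projection onto {p <= n, q <= n}. Then
  P_n (T(t) z - z) / t = Q(t) P_n M z with Q(t) the average of exp(s M) over [0, t], whose entries are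
  bounded by 1 and which tends strongly to 1. So z is in the domain of the generator with image y iff
  P_n y = P_n M z for all n, and testing the duality relation against vectors P_n w gives the same condition.
*)
theory Submission
  imports Defs
begin

section \<open>Complex inner products\<close>

text \<open>The function f is arbitrary at infinity, so f(A) need not be controlled by A, and the
  domain is described only through the sum Au + f(A)v, not by separate conditions on u and v. For
  this reason identities between unbounded operators are stated after applying projections under
  which all functions involved are bounded; letting n grow recovers the vectors. Although M(s) has
  non-real eigenvalues where q < 2p, the entries of exp(tM) are real, so integrals of real functions
  suffice. A contraction of R^2 at every s gives a contraction of the complex space H x H because 1
  - exp(tM)^T exp(tM) is a positive semidefinite matrix of real functions, and completing the square
  pointwise makes it a positive operator. The lower bound of A enters through p: it keeps p away
  from 0, so A^(1/2) has a bounded inverse, M(s) is invertible (its determinant is p^2), and the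
  average of exp(sM) over [0, t] is (exp(tM) - 1) M^(-1) / t.\<close>

lemma cinner_add_right: "cinner x (y + z) = cinner x y + cinner x z"
  by (metis cinner_add_left cinner_commute complex_cnj_add)

lemma cinner_scaleC_right: "cinner x (a *\<^sub>C y) = cnj a * cinner x y"
  by (metis cinner_scaleC_left cinner_commute complex_cnj_mult)

lemma cinner_scaleR_left: "cinner (r *\<^sub>R x) y = r *\<^sub>R cinner x y"
  by (simp add: scaleC_of_real[symmetric] cinner_scaleC_left scaleR_conv_of_real)

lemma cinner_scaleR_right: "cinner x (r *\<^sub>R y) = r *\<^sub>R cinner x y"
  by (simp add: scaleC_of_real[symmetric] cinner_scaleC_right scaleR_conv_of_real)

lemma cinner_self: "cinner x x = complex_of_real ((norm x)\<^sup>2)"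
proof -
  have "Im (cinner x x) = 0"
    using cinner_commute[of x x] by (metis Reals_cnj_iff complex_is_Real_iff)
  moreover have "Re (cinner x x) = (norm x)\<^sup>2"
    by (simp add: norm_eq_sqrt_cinner cinner_ge_zero)
  ultimately show ?thesis
    by (simp add: complex_eq_iff)
qed

lemma Re_cinner_commute: "Re (cinner x y) = Re (cinner y x)"
  by (metis cinner_commute cnj.simps(1))

lemma norm_add_sq:
  fixes x y :: "'a::complex_inner"
  shows "(norm (x + y))\<^sup>2 = (norm x)\<^sup>2 + (norm y)\<^sup>2 + 2 * Re (cinner x y)"
proof -
  have "(norm (x + y))\<^sup>2 = Re (cinner (x + y) (x + y))"
    by (simp add: cinner_self)
  also have "\<dots> = (norm x)\<^sup>2 + (norm y)\<^sup>2 + 2 * Re (cinner x y)"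
    by (simp only: cinner_add_left cinner_add_right)
      (use Re_cinner_commute[of x y] in \<open>simp add: cinner_self\<close>)
  finally show ?thesis .
qed

lemma norm_scaleC:
  fixes x :: "'a::complex_inner"
  shows "norm (a *\<^sub>C x) = cmod a * norm x"
proof -
  have "complex_of_real ((norm (a *\<^sub>C x))\<^sup>2) = complex_of_real ((cmod a * norm x)\<^sup>2)"
    by (simp only: cinner_self[symmetric] cinner_scaleC_left cinner_scaleC_right)
      (simp add: cinner_self power_mult_distrib complex_norm_square mult.commute del: of_real_power)
  then have "(norm (a *\<^sub>C x))\<^sup>2 = (cmod a * norm x)\<^sup>2"
    using of_real_eq_iff by blast
  then show ?thesis
    by (simp add: power2_eq_iff_nonneg)
qed

lemma Re_cinner_le: "Re (cinner x y) \<le> norm x * norm y"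
proof (cases "x = 0 \<or> y = 0")
  case True
  have "cinner 0 w = 0" "cinner w 0 = 0" for w :: 'a
    using cinner_scaleR_left[of 0 0 w] cinner_scaleR_right[of w 0 0] by auto
  with True show ?thesis by auto
next
  case False
  \<comment> \<open>This vector vanishes exactly in the case of equality. Its squared norm is 2 |x|
    |y| times the defect of the inequality.\<close>
  have "0 \<le> (norm (norm y *\<^sub>R x + (- norm x) *\<^sub>R y))\<^sup>2"
    by simp
  also have "\<dots> = 2 * norm x * norm y * (norm x * norm y - Re (cinner x y))"
    by (simp only: norm_add_sq cinner_scaleR_left cinner_scaleR_right)
      (simp add: power2_eq_square algebra_simps)
  finally show ?thesis
    using False by (simp add: zero_le_mult_iff mult_le_0_iff)
qed

text \<open>Multiplying x by the conjugate sign of the inner product keeps its norm and turns the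
  inner product into its modulus, so the bound on real parts applies.\<close>

lemma norm_cinner_le: "cmod (cinner x y) \<le> norm x * norm y"
proof (cases "cinner x y = 0")
  case False
  define a where "a = cnj (sgn (cinner x y))"
  have "a * cinner x y = complex_of_real (cmod (cinner x y))"
    using False by (simp add: a_def sgn_eq field_simps complex_norm_square[symmetric] power2_eq_square)
  then have "Re (cinner (a *\<^sub>C x) y) = cmod (cinner x y)"
    by (simp add: cinner_scaleC_left)
  moreover have "norm (a *\<^sub>C x) = norm x"
    using False by (simp add: norm_scaleC a_def norm_sgn)
  ultimately show ?thesis
    using Re_cinner_le[of "a *\<^sub>C x" y] by simp
qed simp

lemma bounded_bilinear_cinner: "bounded_bilinear cinner"
  by (rule bounded_bilinear.intro)
    (auto simp: cinner_add_left cinner_add_right cinner_scaleR_left cinner_scaleR_right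
      intro!: exI[of _ 1] norm_cinner_le)

interpretation cinner: bounded_bilinear cinner
  by (rule bounded_bilinear_cinner)

lemma bounded_linear_scaleC: "bounded_linear (\<lambda>x::'a::complex_inner. a *\<^sub>C x)"
proof
  show "a *\<^sub>C r *\<^sub>R x = r *\<^sub>R a *\<^sub>C x" for r and x :: 'a
    by (simp add: scaleC_of_real[symmetric] scaleC_scaleC mult.commute)
  show "\<exists>K. \<forall>x::'a. norm (a *\<^sub>C x) \<le> norm x * K"
    by (intro exI[of _ "cmod a"]) (simp add: norm_scaleC mult.commute)
qed (simp add: scaleC_add_right)

lemmas scaleC_sum = linear_sum[OF bounded_linear.linear[OF bounded_linear_scaleC]]
  and scaleC_scaleR = linear_scale[OF bounded_linear.linear[OF bounded_linear_scaleC]]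
  and tendsto_scaleC = bounded_linear.tendsto[OF bounded_linear_scaleC]

lemma cinner_left_eqI:
  assumes "\<And>w. cinner w x = cinner w y"
  shows "x = y"
proof -
  have "cinner (x - y) (x - y) = 0"
    using assms by (simp add: cinner.diff_right)
  then show ?thesis
    by (simp add: cinner_self)
qed

section \<open>Bounded Borel functional calculus\<close>

locale spectral_family =
  fixes E :: "real set \<Rightarrow> 'h::chilbert_space \<Rightarrow> 'h"
  assumes pvm: "pvm E"
begin

lemma E_add: "B \<in> sets borel \<Longrightarrow> E B (x + y) = E B x + E B y"
  and E_scaleC: "B \<in> sets borel \<Longrightarrow> E B (c *\<^sub>C x) = c *\<^sub>C E B x"
  and E_idem: "B \<in> sets borel \<Longrightarrow> E B (E B x) = E B x"
  and E_sym: "B \<in> sets borel \<Longrightarrow> cinner (E B x) y = cinner x (E B y)"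
  and E_UNIV [simp]: "E UNIV x = x"
  and E_Int: "B \<in> sets borel \<Longrightarrow> C \<in> sets borel \<Longrightarrow> E (B \<inter> C) x = E B (E C x)"
  and E_sums: "range Bs \<subseteq> sets borel \<Longrightarrow> disjoint_family Bs \<Longrightarrow>
    (\<lambda>n::nat. E (Bs n) x) sums E (\<Union>n. Bs n) x"
  using pvm unfolding pvm_def clinear_on_def by auto

text \<open>Countable additivity for the constant family of empty sets gives a convergent series
  with equal terms, which must vanish.\<close>

lemma E_empty [simp]: "E {} x = 0"
proof -
  have "(\<lambda>n::nat. E {} x) sums E {} x"
    using E_sums[of "\<lambda>_. {}" x] by (auto simp: disjoint_family_on_def)
  then have "(\<lambda>n::nat. E {} x) \<longlonglongrightarrow> 0"
    by (intro summable_LIMSEQ_zero sums_summable)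
  then show ?thesis
    by (simp add: LIMSEQ_const_iff)
qed

lemma E_Un:
  assumes "B \<in> sets borel" "C \<in> sets borel" "B \<inter> C = {}"
  shows "E (B \<union> C) x = E B x + E C x"
proof -
  let ?F = "binaryset B C"
  have "(\<lambda>n. E (?F n) x) sums E (\<Union>n. ?F n) x"
    using assms
    by (intro E_sums) (auto simp: binaryset_def disjoint_family_on_def)
  moreover have "(\<lambda>n. E (?F n) x) sums (\<Sum>n\<in>{0,1}. E (?F n) x)"
    by (intro sums_finite) (auto simp: binaryset_def)
  ultimately show ?thesis
    by (auto simp: UN_binaryset_eq binaryset_def dest: sums_unique2)
qed

lemma E_UN:
  assumes "finite I" "\<And>i. i \<in> I \<Longrightarrow> B i \<in> sets borel" "disjoint_family_on B I"
  shows "E (\<Union>i\<in>I. B i) x = (\<Sum>i\<in>I. E (B i) x)"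
  using assms
proof (induction I rule: finite_induct)
  case (insert i I)
  have "E (B i \<union> (\<Union>i\<in>I. B i)) x = E (B i) x + E (\<Union>i\<in>I. B i) x"
    using insert by (intro E_Un) (auto simp: disjoint_family_on_def)
  then show ?case
    using insert by (auto simp: disjoint_family_on_def)
qed simp

text \<open>Holds for every symmetric idempotent. Hence the cast to \<open>ennreal\<close> in
  \<open>scalar_measure\<close> truncates nothing, and a set is null for x exactly when its
  projection annihilates x.\<close>

lemma E_norm: "B \<in> sets borel \<Longrightarrow> Re (cinner (E B x) x) = (norm (E B x))\<^sup>2"
  using E_sym[of B "E B x" x] by (simp add: E_idem cinner_self)

lemma sets_scalar_measure [simp, measurable_cong]: "sets (scalar_measure E x) = sets borel"
  and space_scalar_measure [simp]: "space (scalar_measure E x) = UNIV"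
  unfolding scalar_measure_def
  by (simp_all add: sets.sigma_sets_eq[of borel, simplified])

text \<open>\<open>measure_of\<close> returns the prescribed set function only if that function is a
  measure, and the zero measure otherwise; so positivity and countable additivity have to be
  checked.\<close>

lemma emeasure_scalar_measure:
  assumes "B \<in> sets borel"
  shows "emeasure (scalar_measure E x) B = ennreal (Re (cinner (E B x) x))"
proof (rule emeasure_measure_of[OF scalar_measure_def])
  show "positive (sets (scalar_measure E x)) (\<lambda>B. ennreal (Re (cinner (E B x) x)))"
    by (simp add: positive_def cinner.zero_left)
  show "countably_additive (sets (scalar_measure E x)) (\<lambda>B. ennreal (Re (cinner (E B x) x)))"
  proof (rule countably_additiveI)
    fix B :: "nat \<Rightarrow> real set"
    assume B: "range B \<subseteq> sets (scalar_measure E x)" "disjoint_family B"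
    have "(\<lambda>n. Re (cinner (E (B n) x) x)) sums Re (cinner (E (\<Union>n. B n) x) x)"
      using bounded_linear.sums[OF bounded_linear_compose[OF bounded_linear_Re
            cinner.bounded_linear_left[of x]] E_sums[of B x]] B
      by simp
    then show "(\<Sum>n. ennreal (Re (cinner (E (B n) x) x))) = ennreal (Re (cinner (E (\<Union>n. B n) x) x))"
      using B by (intro sums_unique[symmetric] sums_ennreal[THEN iffD2]) (auto simp: E_norm)
  qed
qed (use assms in auto)

lemma emeasure_scalar_measure_UNIV:
  "emeasure (scalar_measure E x) UNIV = ennreal ((norm x)\<^sup>2)"
  by (simp add: emeasure_scalar_measure cinner_self)

section \<open>Integrals of simple functions\<close>

abbreviation SI where "SI \<equiv> simple_spectral_integral E"

text \<open>The definition of the integral sums over the level sets of the integrand itself. Summing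
  over the finer level sets of \<open>q\<close>, whose value type is free, lets several functions
  share one partition. Values in \<open>S\<close> that are not attained contribute
  \<open>E {}\<close>, which is zero.\<close>

lemma SI_comp:
  fixes q :: "real \<Rightarrow> 'b"
  assumes "finite S" "range q \<subseteq> S" "\<And>a. a \<in> S \<Longrightarrow> q -` {a} \<in> sets borel"
  shows "SI (\<lambda>r. p (q r)) x = (\<Sum>a\<in>S. p a *\<^sub>R E (q -` {a}) x)"
proof -
  let ?R = "range (\<lambda>r. p (q r))"
  have fin: "finite ?R"
    using assms by (metis finite_imageI finite_subset image_image)
  have "SI (\<lambda>r. p (q r)) x = (\<Sum>c\<in>?R. c *\<^sub>R E (\<Union>a\<in>{a\<in>range q. p a = c}. q -` {a}) x)"
    unfolding simple_spectral_integral_def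
    by (intro sum.cong refl arg_cong2[where f=scaleR] arg_cong2[where f=E]) auto
  also have "\<dots> = (\<Sum>c\<in>?R. \<Sum>a\<in>{a\<in>range q. p a = c}. p a *\<^sub>R E (q -` {a}) x)"
  proof (intro sum.cong refl)
    fix c assume "c \<in> ?R"
    have "E (\<Union>a\<in>{a\<in>range q. p a = c}. q -` {a}) x = (\<Sum>a\<in>{a\<in>range q. p a = c}. E (q -` {a}) x)"
      using assms by (intro E_UN) (auto simp: disjoint_family_on_def intro: finite_subset)
    then show "c *\<^sub>R E (\<Union>a\<in>{a\<in>range q. p a = c}. q -` {a}) x =
        (\<Sum>a\<in>{a\<in>range q. p a = c}. p a *\<^sub>R E (q -` {a}) x)"
      by (simp add: scaleR_sum_right)
  qed
  also have "\<dots> = (\<Sum>a\<in>range q. p a *\<^sub>R E (q -` {a}) x)"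
    using fin assms by (intro sum.group) (auto intro: finite_subset)
  also have "\<dots> = (\<Sum>a\<in>S. p a *\<^sub>R E (q -` {a}) x)"
  proof (intro sum.mono_neutral_left ballI)
    fix a assume "a \<in> S - range q"
    then have "q -` {a} = {}" by auto
    then show "p a *\<^sub>R E (q -` {a}) x = 0" by simp
  qed (use assms in auto)
  finally show ?thesis .
qed

lemma simple_vimage:
  assumes "simple_function borel s"
  shows "s -` {a} \<in> sets borel"
  using simple_functionD(2)[OF assms, of "{a}"] by simp

lemma simple_range: "simple_function borel s \<Longrightarrow> finite (range s)"
  using simple_functionD(1) by fastforce

text \<open>\<open>SI_comp\<close> for the pair of s and t: the intersections of their level sets
  form a common refinement, from which sums and products are read off.\<close>

lemma SI_pair:
  assumes "simple_function borel s" "simple_function borel t"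
  shows "SI (\<lambda>r. p (s r) (t r)) x =
    (\<Sum>(a, b)\<in>range s \<times> range t. p a b *\<^sub>R E (s -` {a} \<inter> t -` {b}) x)"
proof -
  let ?q = "\<lambda>r. (s r, t r)"
  have v: "?q -` {c} = s -` {fst c} \<inter> t -` {snd c}" for c
    by (auto simp: prod_eq_iff)
  have "SI (\<lambda>r. case_prod p (?q r)) x = (\<Sum>c\<in>range s \<times> range t. case_prod p c *\<^sub>R E (?q -` {c}) x)"
    by (intro SI_comp) (use assms in \<open>auto simp: v simple_range simple_vimage\<close>)
  then show ?thesis
    by (simp add: v case_prod_beta)
qed

lemma SI_add:
  assumes "simple_function borel s" "simple_function borel t"
  shows "SI (\<lambda>r. s r + t r) x = SI s x + SI t x"
  using SI_pair[OF assms, of "\<lambda>a b. a + b"] SI_pair[OF assms, of "\<lambda>a b. a"] SI_pair[OF assms, of "\<lambda>a b. b"]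
  by (simp add: case_prod_beta scaleR_add_left sum.distrib)

lemma SI_cmult:
  assumes "simple_function borel s"
  shows "SI (\<lambda>r. c * s r) x = c *\<^sub>R SI s x"
  using SI_pair[OF assms assms, of "\<lambda>a b. c * a"] SI_pair[OF assms assms, of "\<lambda>a b. a"]
  by (simp add: case_prod_beta scaleR_sum_right)

lemma E_scaleR: "B \<in> sets borel \<Longrightarrow> E B (c *\<^sub>R x) = c *\<^sub>R E B x"
  by (metis E_scaleC scaleC_of_real)

lemma E_sum:
  assumes "B \<in> sets borel"
  shows "E B (\<Sum>i\<in>I. g i) = (\<Sum>i\<in>I. E B (g i))"
proof (cases "finite I")
  case True
  then show ?thesis
    using E_scaleR[OF assms, of 0 0] by (induction I rule: finite_induct) (auto simp: E_add assms)
qed (use E_scaleR[OF assms, of 0 0] in simp)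

lemma SI_mult:
  assumes "simple_function borel s" "simple_function borel t"
  shows "SI (\<lambda>r. s r * t r) x = SI s (SI t x)"
proof -
  have "SI s (SI t x) = (\<Sum>a\<in>range s. \<Sum>b\<in>range t. (a * b) *\<^sub>R E (s -` {a}) (E (t -` {b}) x))"
    using assms
    by (simp add: simple_spectral_integral_def E_sum E_scaleR simple_vimage scaleR_sum_right)
  also have "\<dots> = (\<Sum>a\<in>range s. \<Sum>b\<in>range t. (a * b) *\<^sub>R E (s -` {a} \<inter> t -` {b}) x)"
    using assms by (simp add: E_Int simple_vimage)
  also have "\<dots> = SI (\<lambda>r. s r * t r) x"
    by (simp add: SI_pair[OF assms] sum.cartesian_product)
  finally show ?thesis ..
qed

lemma SI_indicator:
  assumes "B \<in> sets borel"
  shows "SI (indicator B) x = E B x"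
proof -
  have v: "indicator B -` {1::real} = B" "indicator B -` {0::real} = - B"
    by (auto simp: indicator_def)
  have "SI (\<lambda>r. indicator B r) x = (\<Sum>a\<in>{0,1}. a *\<^sub>R E (indicator B -` {a}) x)"
    by (rule SI_comp) (use assms in \<open>auto simp: v indicator_eq_0_iff indicator_eq_1_iff\<close>)
  then show ?thesis
    by (simp add: v)
qed

lemma SI_linear:
  assumes "simple_function borel s"
  shows "SI s (x + y) = SI s x + SI s y" "SI s (c *\<^sub>C x) = c *\<^sub>C SI s x"
  using assms
  by (simp_all add: simple_spectral_integral_def E_add E_scaleC simple_vimage scaleR_add_right
      sum.distrib scaleC_sum scaleC_scaleR)

lemma SI_sym:
  assumes "simple_function borel s"
  shows "cinner (SI s x) y = cinner x (SI s y)"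
  using assms
  by (simp add: simple_spectral_integral_def cinner.sum_left cinner.sum_right
      cinner_scaleR_left cinner_scaleR_right E_sym simple_vimage)

text \<open>Symmetry and multiplicativity turn the squared norm into the form of the integral of s^2
  at x, which is the sum of a^2 times the scalar measure of the level set of a.\<close>

lemma SI_norm:
  assumes "simple_function borel s"
  shows "(\<integral>\<^sup>+ r. ennreal ((s r)\<^sup>2) \<partial>scalar_measure E x) = ennreal ((norm (SI s x))\<^sup>2)"
proof -
  have "(norm (SI s x))\<^sup>2 = Re (cinner (SI s (SI s x)) x)"
    using SI_sym[OF assms, of "SI s x" x] by (simp add: cinner_self)
  also have "\<dots> = Re (cinner (SI (\<lambda>r. (s r)\<^sup>2) x) x)"
    using assms by (simp add: SI_mult power2_eq_square)
  also have "SI (\<lambda>r. (s r)\<^sup>2) x = (\<Sum>a\<in>range s. a\<^sup>2 *\<^sub>R E (s -` {a}) x)"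
    using assms by (intro SI_comp) (auto simp: simple_range simple_vimage)
  finally have *: "(norm (SI s x))\<^sup>2 = (\<Sum>a\<in>range s. a\<^sup>2 * Re (cinner (E (s -` {a}) x) x))"
    by (simp add: cinner.sum_left cinner_scaleR_left)
  have [measurable]: "s -` {a} \<in> sets borel" for a
    using assms by (rule simple_vimage)
  have "ennreal ((s r)\<^sup>2) = (\<Sum>a\<in>range s. ennreal (a\<^sup>2) * indicator (s -` {a}) r)" for r
  proof -
    have "(\<Sum>a\<in>range s. ennreal (a\<^sup>2) * indicator (s -` {a}) r) = (\<Sum>a\<in>range s. if a = s r then ennreal (a\<^sup>2) else 0)"
      by (intro sum.cong) (auto simp: indicator_def)
    then show ?thesis
      using assms by (simp add: simple_range)
  qed
  then have "(\<integral>\<^sup>+ r. ennreal ((s r)\<^sup>2) \<partial>scalar_measure E x) =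
      (\<integral>\<^sup>+ r. (\<Sum>a\<in>range s. ennreal (a\<^sup>2) * indicator (s -` {a}) r) \<partial>scalar_measure E x)"
    by simp
  also have "\<dots> = (\<Sum>a\<in>range s. ennreal (a\<^sup>2) * ennreal (Re (cinner (E (s -` {a}) x) x)))"
    by (simp add: nn_integral_sum nn_integral_cmult_indicator emeasure_scalar_measure)
  also have "\<dots> = ennreal ((norm (SI s x))\<^sup>2)"
    unfolding * using assms
    by (subst sum_ennreal[symmetric])
      (auto simp: ennreal_mult E_norm simple_vimage intro!: sum.cong mult_nonneg_nonneg)
  finally show ?thesis .
qed

section \<open>Integrals of square integrable functions\<close>

definition L2 :: "'h \<Rightarrow> (real \<Rightarrow> real) \<Rightarrow> bool" where
  "L2 x g \<longleftrightarrow> g \<in> borel_measurable borel \<and>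
     (\<integral>\<^sup>+ r. ennreal ((g r)\<^sup>2) \<partial>scalar_measure E x) < \<infinity>"

text \<open>The total companion of \<open>spectral_integral\<close>; its value is determined when
  \<open>L2 x g\<close> holds.\<close>

definition Phi :: "(real \<Rightarrow> real) \<Rightarrow> 'h \<Rightarrow> 'h" where
  "Phi g x = (THE y. is_spectral_integral E g x y)"

definition bounded_borel :: "(real \<Rightarrow> real) \<Rightarrow> bool" where
  "bounded_borel g \<longleftrightarrow> g \<in> borel_measurable borel \<and> (\<exists>K. \<forall>r. \<bar>g r\<bar> \<le> K)"

text \<open>Inserting g between s and t gives (s - t)^2 \<le> 2 (s - g)^2 + 2 (t - g)^2. The
  estimate serves both for the Cauchy property of one approximating sequence and for comparing the
  limits of two.\<close>

lemma SI_diff_le: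
  assumes "simple_function borel s" "simple_function borel t" and [measurable]: "g \<in> borel_measurable borel"
  shows "ennreal ((norm (SI s x - SI t x))\<^sup>2) \<le>
    2 * (\<integral>\<^sup>+ r. ennreal ((s r - g r)\<^sup>2) \<partial>scalar_measure E x) +
    2 * (\<integral>\<^sup>+ r. ennreal ((t r - g r)\<^sup>2) \<partial>scalar_measure E x)"
proof -
  have [measurable]: "s \<in> borel_measurable borel" "t \<in> borel_measurable borel"
    using assms by (auto intro: borel_measurable_simple_function)
  have t': "simple_function borel (\<lambda>r. - 1 * t r)"
    using assms(2) by (rule simple_function_compose1)
  have "SI s x - SI t x = SI (\<lambda>r. s r + - 1 * t r) x"
    by (simp only: SI_add[OF assms(1) t'] SI_cmult[OF assms(2)]) simp
  then have "ennreal ((norm (SI s x - SI t x))\<^sup>2) =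
      (\<integral>\<^sup>+ r. ennreal ((s r - t r)\<^sup>2) \<partial>scalar_measure E x)"
    using SI_norm[OF simple_function_add[OF assms(1) t'], of x] by simp
  also have "\<dots> \<le> (\<integral>\<^sup>+ r. (2 * ennreal ((s r - g r)\<^sup>2) + 2 * ennreal ((t r - g r)\<^sup>2)) \<partial>scalar_measure E x)"
  proof (rule nn_integral_mono)
    fix r
    have "(s r - t r)\<^sup>2 \<le> 2 * (s r - g r)\<^sup>2 + 2 * (t r - g r)\<^sup>2"
      using zero_le_power2[of "(s r - g r) + (t r - g r)"] by (simp add: power2_eq_square algebra_simps)
    then have "ennreal ((s r - t r)\<^sup>2) \<le> ennreal (2 * (s r - g r)\<^sup>2 + 2 * (t r - g r)\<^sup>2)"
      by (rule ennreal_leI)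
    then show "ennreal ((s r - t r)\<^sup>2) \<le> 2 * ennreal ((s r - g r)\<^sup>2) + 2 * ennreal ((t r - g r)\<^sup>2)"
      by (simp add: ennreal_mult)
  qed
  also have "\<dots> = 2 * (\<integral>\<^sup>+ r. ennreal ((s r - g r)\<^sup>2) \<partial>scalar_measure E x) +
    2 * (\<integral>\<^sup>+ r. ennreal ((t r - g r)\<^sup>2) \<partial>scalar_measure E x)"
    by (simp add: nn_integral_add nn_integral_cmult)
  finally show ?thesis .
qed

lemma ennreal_sq_diff_tendsto_0:
  assumes "X \<longlonglongrightarrow> l"
  shows "(\<lambda>n. ennreal ((X n - l)\<^sup>2)) \<longlonglongrightarrow> 0"
  using tendsto_ennrealI[OF tendsto_power[OF tendsto_diff[OF assms tendsto_const[of l]]], of 2] by simp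

lemma tendsto_ennreal_sq_0:
  fixes z :: "'i \<Rightarrow> 'a::real_normed_vector"
  assumes "((\<lambda>i. ennreal ((norm (z i))\<^sup>2)) \<longlongrightarrow> 0) F"
  shows "(z \<longlongrightarrow> 0) F"
proof -
  have "((\<lambda>i. (norm (z i))\<^sup>2) \<longlongrightarrow> 0) F"
    using assms by (subst (asm) ennreal_0[symmetric], subst (asm) tendsto_ennreal_iff) auto
  then have "((\<lambda>i. sqrt ((norm (z i))\<^sup>2)) \<longlongrightarrow> sqrt 0) F"
    by (rule tendsto_real_sqrt)
  then show ?thesis
    by (simp add: tendsto_norm_zero_iff)
qed

text \<open>The approximants are dominated by 2 |g|, so dominated convergence applies with a
  multiple of g^2. The last conclusion carries the isometry \<open>SI_norm\<close> over to the
  limit.\<close>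

lemma L2_approx:
  assumes "L2 x g"
  obtains s where "\<And>n. simple_function borel (s n)"
    "(\<lambda>n. \<integral>\<^sup>+ r. ennreal ((s n r - g r)\<^sup>2) \<partial>scalar_measure E x) \<longlonglongrightarrow> 0"
    "(\<lambda>n. \<integral>\<^sup>+ r. ennreal ((s n r)\<^sup>2) \<partial>scalar_measure E x) \<longlonglongrightarrow>
      (\<integral>\<^sup>+ r. ennreal ((g r)\<^sup>2) \<partial>scalar_measure E x)"
proof -
  let ?M = "scalar_measure E x"
  have [measurable]: "g \<in> borel_measurable borel"
    using assms by (simp add: L2_def)
  obtain s where s: "\<And>n. simple_function borel (s n)" "\<And>r. (\<lambda>n. s n r) \<longlonglongrightarrow> g r"
    "\<And>n r. dist (s n r) 0 \<le> 2 * dist (g r) 0"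
    using borel_measurable_implies_sequence_metric[of g borel 0] by auto
  have [measurable]: "s n \<in> borel_measurable borel" for n
    using s(1) by (rule borel_measurable_simple_function)
  have dom: "\<bar>s n r\<bar> \<le> 2 * \<bar>g r\<bar>" for n r
    using s(3)[of n r] by simp
  \<comment> \<open>The factor 9 is 3^2: both |s n| and |s n - g| are at most 3 |g|.\<close>
  have sq: "(s n r)\<^sup>2 \<le> 9 * (g r)\<^sup>2" "(s n r - g r)\<^sup>2 \<le> 9 * (g r)\<^sup>2" for n r
  proof -
    have "\<bar>s n r\<bar> \<le> 3 * \<bar>g r\<bar>" "\<bar>s n r - g r\<bar> \<le> 3 * \<bar>g r\<bar>"
      using dom[of n r] by linarith+
    then have "\<bar>s n r\<bar>\<^sup>2 \<le> (3 * \<bar>g r\<bar>)\<^sup>2" "\<bar>s n r - g r\<bar>\<^sup>2 \<le> (3 * \<bar>g r\<bar>)\<^sup>2"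
      by (intro power_mono; simp)+
    then show "(s n r)\<^sup>2 \<le> 9 * (g r)\<^sup>2" "(s n r - g r)\<^sup>2 \<le> 9 * (g r)\<^sup>2"
      by (simp_all add: power_mult_distrib)
  qed
  have w: "(\<integral>\<^sup>+ r. ennreal (9 * (g r)\<^sup>2) \<partial>?M) < \<infinity>"
    using assms by (simp add: L2_def ennreal_mult nn_integral_cmult ennreal_mult_less_top)
  have "(\<lambda>n. \<integral>\<^sup>+ r. ennreal ((s n r - g r)\<^sup>2) \<partial>?M) \<longlonglongrightarrow> (\<integral>\<^sup>+ r. 0 \<partial>?M)"
  proof (rule nn_integral_dominated_convergence[OF _ _ _ _ w])
    show "AE r in ?M. (\<lambda>n. ennreal ((s n r - g r)\<^sup>2)) \<longlonglongrightarrow> 0"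
      by (intro AE_I2 ennreal_sq_diff_tendsto_0 s(2))
  qed (auto intro!: ennreal_leI sq)
  moreover have "(\<lambda>n. \<integral>\<^sup>+ r. ennreal ((s n r)\<^sup>2) \<partial>?M) \<longlonglongrightarrow> (\<integral>\<^sup>+ r. ennreal ((g r)\<^sup>2) \<partial>?M)"
  proof (rule nn_integral_dominated_convergence[OF _ _ _ _ w])
    show "AE r in ?M. (\<lambda>n. ennreal ((s n r)\<^sup>2)) \<longlonglongrightarrow> ennreal ((g r)\<^sup>2)"
      by (intro AE_I2 tendsto_intros s(2))
  qed (auto intro!: ennreal_leI sq)
  ultimately show ?thesis
    using s(1) by (intro that) auto
qed

text \<open>\<open>is_spectral_integral\<close> quantifies over all approximating sequences, so
  without any such sequence it would hold vacuously for every y. \<open>L2_approx\<close> supplies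
  one, completeness gives its limit, and \<open>SI_diff_le\<close> shows that every other sequence
  has the same limit; so the \<open>THE\<close> in \<open>Phi\<close> is well defined.\<close>

lemma is_spectral_integral_Phi:
  assumes "L2 x g"
  shows "is_spectral_integral E g x (Phi g x)"
proof -
  let ?M = "scalar_measure E x"
  have [measurable]: "g \<in> borel_measurable borel"
    using assms by (simp add: L2_def)
  obtain s where s: "\<And>n. simple_function borel (s n)"
    "(\<lambda>n. \<integral>\<^sup>+ r. ennreal ((s n r - g r)\<^sup>2) \<partial>?M) \<longlonglongrightarrow> 0"
    "(\<lambda>n. \<integral>\<^sup>+ r. ennreal ((s n r)\<^sup>2) \<partial>?M) \<longlonglongrightarrow>
      (\<integral>\<^sup>+ r. ennreal ((g r)\<^sup>2) \<partial>?M)"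
    by (rule L2_approx[OF assms]) (rule that)
  define e where "e n = (\<integral>\<^sup>+ r. ennreal ((s n r - g r)\<^sup>2) \<partial>?M)" for n
  have "Cauchy (\<lambda>n. SI (s n) x)"
  proof (rule metric_CauchyI)
    fix \<epsilon> :: real assume \<epsilon>: "0 < \<epsilon>"
    have "(\<lambda>n. 2 * e n) \<longlonglongrightarrow> 2 * 0"
      using s(2) unfolding e_def by (intro tendsto_mult_ennreal tendsto_const) auto
    \<comment> \<open>\<open>SI_diff_le\<close> bounds the squared distance by 2 e m + 2 e n, so
      each of the two terms may take half of \<epsilon>^2.\<close>
    then have "eventually (\<lambda>n. 2 * e n < ennreal (\<epsilon>\<^sup>2 / 2)) sequentially"
      using \<epsilon> by (intro order_tendstoD(2)) (auto simp: ennreal_zero_less_divide)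
    then obtain N where N: "\<And>n. n \<ge> N \<Longrightarrow> 2 * e n < ennreal (\<epsilon>\<^sup>2 / 2)"
      by (auto simp: eventually_sequentially)
    have "dist (SI (s m) x) (SI (s n) x) < \<epsilon>" if "m \<ge> N" "n \<ge> N" for m n
    proof -
      have "ennreal ((norm (SI (s m) x - SI (s n) x))\<^sup>2) \<le> 2 * e m + 2 * e n"
        unfolding e_def using s(1) by (intro SI_diff_le) auto
      also have "\<dots> < ennreal (\<epsilon>\<^sup>2 / 2) + ennreal (\<epsilon>\<^sup>2 / 2)"
        using N that by (intro add_strict_mono) auto
      also have "\<dots> = ennreal (\<epsilon>\<^sup>2)"
        using \<epsilon> by (subst ennreal_plus[symmetric]) auto
      finally have "(norm (SI (s m) x - SI (s n) x))\<^sup>2 < \<epsilon>\<^sup>2"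
        by (simp add: ennreal_less_iff)
      then show ?thesis
        using \<epsilon> by (simp add: dist_norm power2_less_imp_less)
    qed
    then show "\<exists>N. \<forall>m\<ge>N. \<forall>n\<ge>N. dist (SI (s m) x) (SI (s n) x) < \<epsilon>"
      by blast
  qed
  then obtain y where y: "(\<lambda>n. SI (s n) x) \<longlonglongrightarrow> y"
    using Cauchy_convergent_iff convergent_def by blast
  have "is_spectral_integral E g x y"
    unfolding is_spectral_integral_def
  proof (intro allI impI, elim conjE)
    fix t :: "nat \<Rightarrow> real \<Rightarrow> real"
    assume t: "\<forall>n. simple_function borel (t n)"
      "(\<lambda>n. \<integral>\<^sup>+ r. ennreal ((t n r - g r)\<^sup>2) \<partial>?M) \<longlonglongrightarrow> 0"
    have "(\<lambda>n. 2 * (\<integral>\<^sup>+ r. ennreal ((t n r - g r)\<^sup>2) \<partial>?M) + 2 * e n) \<longlonglongrightarrow> 2 * 0 + 2 * 0"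
      using s(2) t(2) unfolding e_def by (intro tendsto_mult_ennreal tendsto_const tendsto_add) auto
    then have lim: "(\<lambda>n. 2 * (\<integral>\<^sup>+ r. ennreal ((t n r - g r)\<^sup>2) \<partial>?M) + 2 * e n) \<longlonglongrightarrow> 0"
      by simp
    have le: "ennreal ((norm (SI (t n) x - SI (s n) x))\<^sup>2) \<le>
        2 * (\<integral>\<^sup>+ r. ennreal ((t n r - g r)\<^sup>2) \<partial>?M) + 2 * e n" for n
      unfolding e_def using s(1) t(1) by (intro SI_diff_le) auto
    have "(\<lambda>n. ennreal ((norm (SI (t n) x - SI (s n) x))\<^sup>2)) \<longlonglongrightarrow> 0"
      by (rule tendsto_sandwich[OF _ _ tendsto_const lim]) (auto intro: always_eventually le)
    then have "(\<lambda>n. SI (t n) x - SI (s n) x) \<longlonglongrightarrow> 0"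
      by (rule tendsto_ennreal_sq_0)
    from tendsto_add[OF this y] show "(\<lambda>n. SI (t n) x) \<longlonglongrightarrow> y"
      by simp
  qed
  moreover have "y' = y" if "is_spectral_integral E g x y'" for y'
    using that s y unfolding is_spectral_integral_def by (blast intro: LIMSEQ_unique)
  ultimately show ?thesis
    unfolding Phi_def by (rule theI)
qed

lemma Phi_limit:
  assumes "L2 x g" "\<And>n. simple_function borel (s n)"
    "(\<lambda>n. \<integral>\<^sup>+ r. ennreal ((s n r - g r)\<^sup>2) \<partial>scalar_measure E x) \<longlonglongrightarrow> 0"
  shows "(\<lambda>n. SI (s n) x) \<longlonglongrightarrow> Phi g x"
  using is_spectral_integral_Phi[OF assms(1)] assms(2,3) unfolding is_spectral_integral_def by blast

lemma spectral_integral_Phi: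
  assumes "g \<in> borel_measurable borel"
  shows "spectral_integral E g x = (if L2 x g then Some (Phi g x) else None)"
  using assms by (auto simp: spectral_integral_def L2_def Phi_def)

lemma Phi_norm:
  assumes "L2 x g"
  shows "(\<integral>\<^sup>+ r. ennreal ((g r)\<^sup>2) \<partial>scalar_measure E x) = ennreal ((norm (Phi g x))\<^sup>2)"
proof -
  obtain s where s: "\<And>n. simple_function borel (s n)"
    "(\<lambda>n. \<integral>\<^sup>+ r. ennreal ((s n r - g r)\<^sup>2) \<partial>scalar_measure E x) \<longlonglongrightarrow> 0"
    "(\<lambda>n. \<integral>\<^sup>+ r. ennreal ((s n r)\<^sup>2) \<partial>scalar_measure E x) \<longlonglongrightarrow>
      (\<integral>\<^sup>+ r. ennreal ((g r)\<^sup>2) \<partial>scalar_measure E x)"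
    by (rule L2_approx[OF assms]) (rule that)
  have "(\<lambda>n. ennreal ((norm (SI (s n) x))\<^sup>2)) \<longlonglongrightarrow> ennreal ((norm (Phi g x))\<^sup>2)"
    by (intro tendsto_intros Phi_limit assms s)
  then show ?thesis
    using s(1,3) by (simp add: SI_norm LIMSEQ_unique)
qed

section \<open>The algebra of integrals of bounded Borel functions\<close>

lemma bounded_borelE:
  assumes "bounded_borel g"
  obtains K where "\<And>r. \<bar>g r\<bar> \<le> K" "0 \<le> K"
proof -
  obtain K where K: "\<And>r. \<bar>g r\<bar> \<le> K"
    using assms unfolding bounded_borel_def by blast
  have "0 \<le> K"
    using order_trans[OF abs_ge_zero K] .
  with K show ?thesis by (rule that)
qed

lemma bounded_borel_measurable [measurable_dest]: "bounded_borel g \<Longrightarrow> g \<in> borel_measurable borel"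
  by (simp add: bounded_borel_def)

lemma bounded_borel_const [intro!]: "bounded_borel (\<lambda>r. c)"
  by (auto simp: bounded_borel_def)

lemma bounded_borel_indicator [intro!]: "B \<in> sets borel \<Longrightarrow> bounded_borel (indicator B)"
  by (auto simp: bounded_borel_def indicator_def intro!: exI[of _ 1])

lemma bounded_borel_add [intro!]:
  assumes "bounded_borel g" "bounded_borel h"
  shows "bounded_borel (\<lambda>r. g r + h r)"
proof -
  obtain K where "\<And>r. \<bar>g r\<bar> \<le> K"
    using bounded_borelE[OF assms(1)] by blast
  moreover obtain L where "\<And>r. \<bar>h r\<bar> \<le> L"
    using bounded_borelE[OF assms(2)] by blast
  ultimately have "\<bar>g r + h r\<bar> \<le> K + L" for r
    by (metis abs_triangle_ineq add_mono order_trans)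
  then show ?thesis
    using assms by (auto simp: bounded_borel_def)
qed

lemma bounded_borel_mult [intro!]:
  assumes "bounded_borel g" "bounded_borel h"
  shows "bounded_borel (\<lambda>r. g r * h r)"
proof -
  obtain K where "\<And>r. \<bar>g r\<bar> \<le> K" "0 \<le> K"
    using bounded_borelE[OF assms(1)] by blast
  moreover obtain L where "\<And>r. \<bar>h r\<bar> \<le> L"
    using bounded_borelE[OF assms(2)] by blast
  ultimately have "\<bar>g r * h r\<bar> \<le> K * L" for r
    by (simp add: abs_mult mult_mono)
  then show ?thesis
    using assms by (auto simp: bounded_borel_def)
qed

lemma bounded_borel_minus [intro!]: "bounded_borel g \<Longrightarrow> bounded_borel (\<lambda>r. - g r)"
  by (auto simp: bounded_borel_def)

lemma bounded_borel_diff [intro!]: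
  "bounded_borel g \<Longrightarrow> bounded_borel h \<Longrightarrow> bounded_borel (\<lambda>r. g r - h r)"
  using bounded_borel_add[of g "\<lambda>r. - h r"] by auto

lemma bounded_borel_simple: "simple_function borel s \<Longrightarrow> bounded_borel s"
  using simple_range[of s] finite_imp_bounded[of "range s"]
  by (auto simp: bounded_borel_def bounded_iff borel_measurable_simple_function)

text \<open>The scalar measures are finite, so the constant (2 K)^2 is an integrable
  majorant.\<close>

lemma bounded_convergence:
  assumes [measurable]: "\<And>n. g n \<in> borel_measurable borel" "h \<in> borel_measurable borel"
    and bd: "\<And>n r. \<bar>g n r\<bar> \<le> K"
    and lim: "\<And>r. (\<lambda>n. g n r) \<longlonglongrightarrow> h r"
  shows "(\<lambda>n. \<integral>\<^sup>+ r. ennreal ((g n r - h r)\<^sup>2) \<partial>scalar_measure E x) \<longlonglongrightarrow> 0"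
proof -
  let ?M = "scalar_measure E x"
  have hK: "\<bar>h r\<bar> \<le> K" for r
    using lim[of r] bd by (intro LIMSEQ_le_const2[OF tendsto_rabs]) auto
  have "\<bar>g n r - h r\<bar> \<le> 2 * K" for n r
    using hK[of r] bd[of n r] by linarith
  then have sq: "(g n r - h r)\<^sup>2 \<le> 4 * K\<^sup>2" for n r
    using power_mono[of "\<bar>g n r - h r\<bar>" "2 * K" 2] by (simp add: power_mult_distrib)
  have "(\<lambda>n. \<integral>\<^sup>+ r. ennreal ((g n r - h r)\<^sup>2) \<partial>?M) \<longlonglongrightarrow> (\<integral>\<^sup>+ r. 0 \<partial>?M)"
  proof (rule nn_integral_dominated_convergence)
    show "AE r in ?M. (\<lambda>n. ennreal ((g n r - h r)\<^sup>2)) \<longlonglongrightarrow> 0"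
      by (intro AE_I2 ennreal_sq_diff_tendsto_0 lim)
    show "(\<integral>\<^sup>+ r. ennreal (4 * K\<^sup>2) \<partial>?M) < \<infinity>"
      by (simp add: emeasure_scalar_measure_UNIV ennreal_mult_less_top)
  qed (auto intro!: ennreal_leI sq)
  then show ?thesis by simp
qed

lemma L2_bounded:
  assumes "bounded_borel g"
  shows "L2 x g"
proof -
  obtain K where K: "\<And>r. \<bar>g r\<bar> \<le> K" "0 \<le> K"
    using bounded_borelE[OF assms] by blast
  have "(\<integral>\<^sup>+ r. ennreal ((g r)\<^sup>2) \<partial>scalar_measure E x) \<le> (\<integral>\<^sup>+ r. ennreal (K\<^sup>2) \<partial>scalar_measure E x)"
    using K power_mono[OF K(1), where n=2] by (intro nn_integral_mono ennreal_leI) simp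
  also have "\<dots> < \<infinity>"
    by (simp add: emeasure_scalar_measure_UNIV ennreal_mult_less_top)
  finally show ?thesis
    using assms by (simp add: L2_def bounded_borel_def)
qed

text \<open>Through this lemma \<open>Phi\<close> inherits the algebraic rules below from the
  corresponding rules for \<open>SI\<close>.\<close>

lemma SI_tendsto_Phi:
  assumes "\<And>n. simple_function borel (s n)" "\<And>n r. \<bar>s n r\<bar> \<le> K" "\<And>r. (\<lambda>n. s n r) \<longlonglongrightarrow> g r"
  shows "(\<lambda>n. SI (s n) x) \<longlonglongrightarrow> Phi g x"
proof -
  have [measurable]: "s n \<in> borel_measurable borel" for n
    using assms(1) by (rule borel_measurable_simple_function)
  have g [measurable]: "g \<in> borel_measurable borel"
    by (rule borel_measurable_LIMSEQ_real[where u=s]) (use assms(3) in auto)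
  have "\<bar>g r\<bar> \<le> K" for r
    by (rule LIMSEQ_le_const2[OF tendsto_rabs[OF assms(3)]]) (use assms(2) in auto)
  with g have "bounded_borel g"
    by (auto simp: bounded_borel_def)
  then show ?thesis
    by (intro Phi_limit L2_bounded bounded_convergence[where K=K] assms) auto
qed

lemma Phi_simple:
  assumes "simple_function borel s"
  shows "Phi s x = SI s x"
proof -
  obtain K where K: "\<And>r. \<bar>s r\<bar> \<le> K"
    using bounded_borelE[OF bounded_borel_simple[OF assms]] by blast
  have "(\<lambda>n. SI s x) \<longlonglongrightarrow> Phi s x"
    by (rule SI_tendsto_Phi[OF assms K tendsto_const])
  then show ?thesis
    by (simp add: LIMSEQ_const_iff)
qed

lemma Phi_indicator: "B \<in> sets borel \<Longrightarrow> Phi (indicator B) x = E B x"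
  by (simp add: Phi_simple SI_indicator)

lemma bounded_borel_approx:
  assumes "bounded_borel g"
  obtains s K where "\<And>n. simple_function borel (s n)" "\<And>n r. \<bar>s n r\<bar> \<le> K"
    "\<And>r. (\<lambda>n. s n r) \<longlonglongrightarrow> g r"
proof -
  obtain s where s: "\<And>n. simple_function borel (s n)" "\<And>r. (\<lambda>n. s n r) \<longlonglongrightarrow> g r"
    "\<And>n r. dist (s n r) 0 \<le> 2 * dist (g r) 0"
    using borel_measurable_implies_sequence_metric[of g borel 0] assms by (auto simp: bounded_borel_def)
  obtain K where K: "\<And>r. \<bar>g r\<bar> \<le> K"
    using bounded_borelE[OF assms] by blast
  have "\<bar>s n r\<bar> \<le> 2 * K" for n r
    using s(3)[of n r] K[of r] by simp
  with s that show ?thesis by blast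
qed

lemma Phi_add:
  assumes "bounded_borel g" "bounded_borel h"
  shows "Phi (\<lambda>r. g r + h r) x = Phi g x + Phi h x"
proof -
  obtain s K where s: "\<And>n. simple_function borel (s n)" "\<And>n r. \<bar>s n r\<bar> \<le> K" "\<And>r. (\<lambda>n. s n r) \<longlonglongrightarrow> g r"
    by (rule bounded_borel_approx[OF assms(1)]) (rule that)
  obtain t L where t: "\<And>n. simple_function borel (t n)" "\<And>n r. \<bar>t n r\<bar> \<le> L" "\<And>r. (\<lambda>n. t n r) \<longlonglongrightarrow> h r"
    by (rule bounded_borel_approx[OF assms(2)]) (rule that)
  have "(\<lambda>n. SI (\<lambda>r. s n r + t n r) x) \<longlonglongrightarrow> Phi (\<lambda>r. g r + h r) x"
  proof (rule SI_tendsto_Phi)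
    show "\<bar>s n r + t n r\<bar> \<le> K + L" for n r
      using s(2)[of n r] t(2)[of n r] by linarith
  qed (auto intro!: tendsto_add s t)
  moreover have "(\<lambda>n. SI (s n) x + SI (t n) x) \<longlonglongrightarrow> Phi g x + Phi h x"
    by (intro tendsto_add SI_tendsto_Phi[OF s] SI_tendsto_Phi[OF t])
  ultimately show ?thesis
    using s(1) t(1) by (simp add: SI_add LIMSEQ_unique)
qed

lemma Phi_cmult:
  assumes "bounded_borel g"
  shows "Phi (\<lambda>r. c * g r) x = c *\<^sub>R Phi g x"
proof -
  obtain s K where s: "\<And>n. simple_function borel (s n)" "\<And>n r. \<bar>s n r\<bar> \<le> K" "\<And>r. (\<lambda>n. s n r) \<longlonglongrightarrow> g r"
    by (rule bounded_borel_approx[OF assms(1)]) (rule that)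
  have "(\<lambda>n. SI (\<lambda>r. c * s n r) x) \<longlonglongrightarrow> Phi (\<lambda>r. c * g r) x"
    by (rule SI_tendsto_Phi[where K="\<bar>c\<bar> * K"]) (auto intro!: tendsto_mult mult_left_mono s simp: abs_mult)
  moreover have "(\<lambda>n. c *\<^sub>R SI (s n) x) \<longlonglongrightarrow> c *\<^sub>R Phi g x"
    by (intro tendsto_intros SI_tendsto_Phi[OF s])
  ultimately show ?thesis
    using s(1) by (simp add: SI_cmult LIMSEQ_unique)
qed

lemma Phi_minus: "bounded_borel g \<Longrightarrow> Phi (\<lambda>r. - g r) x = - Phi g x"
  using Phi_cmult[of g "-1"] by simp

lemma Phi_diff: "bounded_borel g \<Longrightarrow> bounded_borel h \<Longrightarrow> Phi (\<lambda>r. g r - h r) x = Phi g x - Phi h x"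
  using Phi_add[of g "\<lambda>r. - h r"] by (auto simp: Phi_minus)

lemma Phi_linear:
  assumes "bounded_borel g"
  shows "Phi g (x + y) = Phi g x + Phi g y" "Phi g (c *\<^sub>C x) = c *\<^sub>C Phi g x"
proof -
  obtain s K where s: "\<And>n. simple_function borel (s n)" "\<And>n r. \<bar>s n r\<bar> \<le> K" "\<And>r. (\<lambda>n. s n r) \<longlonglongrightarrow> g r"
    by (rule bounded_borel_approx[OF assms(1)]) (rule that)
  have lim: "(\<lambda>n. SI (s n) z) \<longlonglongrightarrow> Phi g z" for z
    by (rule SI_tendsto_Phi[OF s])
  show "Phi g (x + y) = Phi g x + Phi g y"
    using lim[of "x + y"] tendsto_add[OF lim[of x] lim[of y]] s(1)
    by (simp add: SI_linear LIMSEQ_unique)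
  show "Phi g (c *\<^sub>C x) = c *\<^sub>C Phi g x"
    using lim[of "c *\<^sub>C x"] tendsto_scaleC[OF lim[of x]] s(1)
    by (simp add: SI_linear LIMSEQ_unique)
qed

lemma Phi_sym:
  assumes "bounded_borel g"
  shows "cinner (Phi g x) y = cinner x (Phi g y)"
proof -
  obtain s K where s: "\<And>n. simple_function borel (s n)" "\<And>n r. \<bar>s n r\<bar> \<le> K" "\<And>r. (\<lambda>n. s n r) \<longlonglongrightarrow> g r"
    by (rule bounded_borel_approx[OF assms(1)]) (rule that)
  have lim: "(\<lambda>n. SI (s n) z) \<longlonglongrightarrow> Phi g z" for z
    by (rule SI_tendsto_Phi[OF s])
  show ?thesis
    using cinner.tendsto[OF lim[of x] tendsto_const[of y]] cinner.tendsto[OF tendsto_const[of x] lim[of y]] s(1)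
    by (simp add: SI_sym LIMSEQ_unique)
qed

lemma Phi_norm_le:
  assumes "bounded_borel g" "\<And>r. \<bar>g r\<bar> \<le> K"
  shows "norm (Phi g x) \<le> K * norm x"
proof -
  have K: "0 \<le> K"
    using assms(2)[of 0] by simp
  have "ennreal ((norm (Phi g x))\<^sup>2) = (\<integral>\<^sup>+ r. ennreal ((g r)\<^sup>2) \<partial>scalar_measure E x)"
    using assms(1) by (simp add: Phi_norm L2_bounded)
  also have "\<dots> \<le> (\<integral>\<^sup>+ r. ennreal (K\<^sup>2) \<partial>scalar_measure E x)"
    using power_mono[OF assms(2), where n=2] by (intro nn_integral_mono ennreal_leI) simp
  also have "\<dots> = ennreal ((K * norm x)\<^sup>2)"
    by (simp add: emeasure_scalar_measure_UNIV ennreal_mult power_mult_distrib)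
  finally have "(norm (Phi g x))\<^sup>2 \<le> (K * norm x)\<^sup>2"
    by simp
  then show ?thesis
    by (rule power2_le_imp_le) (use K in simp)
qed

lemma bounded_linear_Phi:
  assumes "bounded_borel g"
  shows "bounded_linear (Phi g)"
proof -
  obtain K where K: "\<And>r. \<bar>g r\<bar> \<le> K"
    using bounded_borelE[OF assms] by blast
  show ?thesis
    by (rule bounded_linear_intro[where K=K])
      (use Phi_linear[OF assms] Phi_norm_le[OF assms K] in \<open>auto simp: scaleC_of_real[symmetric] mult.commute\<close>)
qed

lemma Phi_tendsto:
  assumes "\<And>n. bounded_borel (g n)" "bounded_borel h" "\<And>n r. \<bar>g n r\<bar> \<le> K"
    and "\<And>r. (\<lambda>n. g n r) \<longlonglongrightarrow> h r"
  shows "(\<lambda>n. Phi (g n) x) \<longlonglongrightarrow> Phi h x"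
proof -
  have "(\<lambda>n. \<integral>\<^sup>+ r. ennreal ((g n r - h r)\<^sup>2) \<partial>scalar_measure E x) \<longlonglongrightarrow> 0"
    using assms by (intro bounded_convergence) (auto simp: bounded_borel_def)
  moreover have "(\<integral>\<^sup>+ r. ennreal ((g n r - h r)\<^sup>2) \<partial>scalar_measure E x) =
      ennreal ((norm (Phi (g n) x - Phi h x))\<^sup>2)" for n
    using assms by (subst Phi_norm) (auto simp: Phi_diff intro!: L2_bounded)
  ultimately have "(\<lambda>n. Phi (g n) x - Phi h x) \<longlonglongrightarrow> 0"
    by (intro tendsto_ennreal_sq_0) simp
  then show ?thesis
    by (simp add: LIM_zero_iff)
qed

text \<open>The factors are approximated one after the other: for a simple second factor the rule is
  a limit of \<open>SI_mult\<close>, and then the continuity of \<open>Phi g\<close> lets the second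
  factor tend to h.\<close>

lemma Phi_mult:
  assumes "bounded_borel g" "bounded_borel h"
  shows "Phi (\<lambda>r. g r * h r) x = Phi g (Phi h x)"
proof -
  obtain s K where s: "\<And>n. simple_function borel (s n)" "\<And>n r. \<bar>s n r\<bar> \<le> K" "\<And>r. (\<lambda>n. s n r) \<longlonglongrightarrow> g r"
    by (rule bounded_borel_approx[OF assms(1)]) (rule that)
  obtain t L where t: "\<And>n. simple_function borel (t n)" "\<And>n r. \<bar>t n r\<bar> \<le> L" "\<And>r. (\<lambda>n. t n r) \<longlonglongrightarrow> h r"
    by (rule bounded_borel_approx[OF assms(2)]) (rule that)
  obtain G where G: "\<And>r. \<bar>g r\<bar> \<le> G" "0 \<le> G"
    using bounded_borelE[OF assms(1)] by blast
  have 1: "Phi (\<lambda>r. g r * t j r) x = Phi g (Phi (t j) x)" for j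
  proof -
    have "\<bar>s n r\<bar> * \<bar>t j r\<bar> \<le> K * L" for n r
      using s(2)[of n r] t(2)[of j r] by (intro mult_mono) auto
    then have "(\<lambda>n. SI (\<lambda>r. s n r * t j r) x) \<longlonglongrightarrow> Phi (\<lambda>r. g r * t j r) x"
      by (intro SI_tendsto_Phi[where K="K * L"]) (auto intro!: tendsto_mult s t simp: abs_mult)
    moreover have "(\<lambda>n. SI (s n) (SI (t j) x)) \<longlonglongrightarrow> Phi g (SI (t j) x)"
      by (rule SI_tendsto_Phi[OF s])
    ultimately show ?thesis
      using s(1) t(1) by (simp add: SI_mult Phi_simple LIMSEQ_unique)
  qed
  have "\<bar>g r\<bar> * \<bar>t j r\<bar> \<le> G * L" for j r
    using t(2)[of j r] G by (intro mult_mono) auto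
  then have "(\<lambda>j. Phi (\<lambda>r. g r * t j r) x) \<longlonglongrightarrow> Phi (\<lambda>r. g r * h r) x"
    using assms t
    by (intro Phi_tendsto[where K="G * L"])
      (auto intro!: tendsto_mult simp: abs_mult bounded_borel_simple)
  moreover have "(\<lambda>j. Phi g (Phi (t j) x)) \<longlonglongrightarrow> Phi g (Phi h x)"
    using SI_tendsto_Phi[OF t]
    by (intro bounded_linear.tendsto[OF bounded_linear_Phi[OF assms(1)]]) (simp add: Phi_simple t)
  ultimately show ?thesis
    by (simp add: 1 LIMSEQ_unique)
qed

section \<open>Exhausting cutoffs and unbounded integrands\<close>

definition exhausts :: "(nat \<Rightarrow> real set) \<Rightarrow> bool" where
  "exhausts B \<longleftrightarrow> range B \<subseteq> sets borel \<and> incseq B \<and> (\<Union>n. B n) = UNIV"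

lemma exhausts_sets: "exhausts B \<Longrightarrow> B n \<in> sets borel"
  by (auto simp: exhausts_def)

lemma exhausts_level:
  assumes [measurable]: "g \<in> borel_measurable borel"
  shows "exhausts (\<lambda>n. {r. \<bar>g r\<bar> \<le> real n})"
  unfolding exhausts_def
proof (intro conjI)
  show "(\<Union>n. {r. \<bar>g r\<bar> \<le> real n}) = UNIV"
    using real_arch_simple by auto
  show "incseq (\<lambda>n. {r. \<bar>g r\<bar> \<le> real n})"
    by (auto simp: incseq_def)
qed auto

lemma exhausts_Int:
  assumes "exhausts B" "exhausts C"
  shows "exhausts (\<lambda>n. B n \<inter> C n)"
  unfolding exhausts_def
proof (intro conjI)
  have inc: "incseq B" "incseq C"
    using assms by (auto simp: exhausts_def)
  then show "incseq (\<lambda>n. B n \<inter> C n)"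
    unfolding incseq_def by blast
  have "\<exists>n. r \<in> B n \<inter> C n" for r
  proof -
    obtain i j where "r \<in> B i" "r \<in> C j"
      using assms unfolding exhausts_def by blast
    moreover have "B i \<subseteq> B (max i j)" "C j \<subseteq> C (max i j)"
      using inc by (auto simp: incseq_def)
    ultimately show ?thesis by blast
  qed
  then show "(\<Union>n. B n \<inter> C n) = UNIV" by blast
qed (use assms in \<open>auto simp: exhausts_def\<close>)

lemma bounded_borel_cutoff:
  assumes "g \<in> borel_measurable borel" "C \<in> sets borel" "\<And>r. r \<in> C \<Longrightarrow> \<bar>g r\<bar> \<le> K"
  shows "bounded_borel (\<lambda>r. g r * indicator C r)"
proof -
  have "\<bar>g r * indicator C r\<bar> \<le> \<bar>K\<bar>" for r
    using assms(3)[of r] by (auto simp: indicator_def)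
  then show ?thesis
    using assms(1,2) by (auto simp: bounded_borel_def)
qed

lemma E_norm_le: "B \<in> sets borel \<Longrightarrow> norm (E B x) \<le> norm x"
  using Phi_norm_le[of "indicator B" 1 x] by (auto simp: Phi_indicator indicator_def)

lemma Phi_one: "Phi (\<lambda>r. 1) x = x"
  using Phi_indicator[of UNIV x] by simp

lemma Phi_zero: "Phi (\<lambda>r. 0) x = 0"
  using Phi_cmult[of "\<lambda>r. 0" 0 x] by auto

lemma cutoff_tendsto:
  assumes "exhausts B"
  shows "(\<lambda>n. E (B n) y) \<longlonglongrightarrow> y"
proof -
  have "(\<lambda>n. Phi (indicator (B n)) y) \<longlonglongrightarrow> Phi (indicator (\<Union>n. B n)) y"
    using assms
    by (intro Phi_tendsto[where K=1] bounded_borel_indicator LIMSEQ_indicator_incseq)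
      (auto simp: exhausts_def split: split_indicator)
  then show ?thesis
    using assms by (simp add: Phi_indicator exhausts_sets) (simp add: exhausts_def Phi_one)
qed

lemma cutoff_eqI:
  assumes "exhausts B" "\<And>n. E (B n) y = E (B n) z"
  shows "y = z"
  using cutoff_tendsto[OF assms(1), of y] cutoff_tendsto[OF assms(1), of z]
  by (simp add: assms(2) LIMSEQ_unique)

text \<open>Replaces the limit definition of an unbounded integral by bounded identities. For square
  integrable g the projection moves inside the approximating sums. Conversely, by the isometry the
  integral of g^2 over each \<open>B n\<close> is at most |y|^2, so g is square integrable by
  monotone convergence, and \<open>cutoff_eqI\<close> identifies the value.\<close>

lemma spectral_integral_iff:
  assumes g [measurable]: "g \<in> borel_measurable borel" and B: "exhausts B"
    and bd: "\<And>n. bounded_borel (\<lambda>r. g r * indicator (B n) r)"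
  shows "spectral_integral E g x = Some y \<longleftrightarrow>
    (\<forall>n. E (B n) y = Phi (\<lambda>r. g r * indicator (B n) r) x)"
proof -
  let ?M = "scalar_measure E x"
  have [measurable]: "B n \<in> sets borel" for n
    using B by (rule exhausts_sets)
  have 1: "E (B n) (Phi g x) = Phi (\<lambda>r. g r * indicator (B n) r) x" if L2: "L2 x g" for n
  proof -
    obtain s where s: "\<And>n. simple_function borel (s n)"
      "(\<lambda>n. \<integral>\<^sup>+ r. ennreal ((s n r - g r)\<^sup>2) \<partial>?M) \<longlonglongrightarrow> 0"
      "(\<lambda>n. \<integral>\<^sup>+ r. ennreal ((s n r)\<^sup>2) \<partial>?M) \<longlonglongrightarrow> (\<integral>\<^sup>+ r. ennreal ((g r)\<^sup>2) \<partial>?M)"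
      by (rule L2_approx[OF L2]) (rule that)
    have ind: "simple_function borel (\<lambda>r. indicator (B n) r :: real)"
      by (rule simple_function_indicator) simp
    \<comment> \<open>Multiplying by an indicator only decreases the distance to g.\<close>
    have "(\<lambda>k. \<integral>\<^sup>+ r. ennreal ((s k r * indicator (B n) r - g r * indicator (B n) r)\<^sup>2) \<partial>?M) \<longlonglongrightarrow> 0"
      by (rule tendsto_sandwich[OF _ _ tendsto_const s(2)])
        (auto intro!: always_eventually nn_integral_mono split: split_indicator)
    then have "(\<lambda>k. SI (\<lambda>r. s k r * indicator (B n) r) x) \<longlonglongrightarrow> Phi (\<lambda>r. g r * indicator (B n) r) x"
      using s(1) ind by (intro Phi_limit L2_bounded bd) auto
    moreover have "SI (\<lambda>r. s k r * indicator (B n) r) x = Phi (indicator (B n)) (SI (s k) x)" for k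
      using SI_mult[OF ind s(1), of k x] by (simp add: mult.commute Phi_indicator SI_indicator)
    moreover have "(\<lambda>k. Phi (indicator (B n)) (SI (s k) x)) \<longlonglongrightarrow> Phi (indicator (B n)) (Phi g x)"
      by (intro bounded_linear.tendsto[OF bounded_linear_Phi] Phi_limit[OF L2] s) auto
    ultimately show ?thesis
      by (simp add: Phi_indicator LIMSEQ_unique)
  qed
  have 2: "L2 x g" if y: "\<And>n. E (B n) y = Phi (\<lambda>r. g r * indicator (B n) r) x"
  proof -
    have lim: "(\<lambda>n. \<integral>\<^sup>+ r. ennreal ((g r * indicator (B n) r)\<^sup>2) \<partial>?M) \<longlonglongrightarrow> (\<integral>\<^sup>+ r. ennreal ((g r)\<^sup>2) \<partial>?M)"
    proof (rule nn_integral_LIMSEQ)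
      show "incseq (\<lambda>n r. ennreal ((g r * indicator (B n) r)\<^sup>2))"
        using B unfolding exhausts_def incseq_def le_fun_def
        by (auto intro!: ennreal_leI split: split_indicator)
      show "(\<lambda>n. ennreal ((g r * indicator (B n) r)\<^sup>2)) \<longlonglongrightarrow> ennreal ((g r)\<^sup>2)" for r
      proof -
        have "(\<lambda>n. indicator (B n) r :: real) \<longlonglongrightarrow> indicator (\<Union>n. B n) r"
          using B by (intro LIMSEQ_indicator_incseq) (auto simp: exhausts_def)
        then have "(\<lambda>n. ennreal ((g r * indicator (B n) r)\<^sup>2)) \<longlonglongrightarrow> ennreal ((g r * indicator (\<Union>n. B n) r)\<^sup>2)"
          by (intro tendsto_intros)
        then show ?thesis
          using B by (simp add: exhausts_def)
      qed
    qed auto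
    have le: "(\<integral>\<^sup>+ r. ennreal ((g r * indicator (B n) r)\<^sup>2) \<partial>?M) \<le> ennreal ((norm y)\<^sup>2)" for n
      by (simp add: Phi_norm L2_bounded bd y[symmetric] E_norm_le power_mono del: power_mult_distrib)
    have "(\<integral>\<^sup>+ r. ennreal ((g r)\<^sup>2) \<partial>?M) \<le> ennreal ((norm y)\<^sup>2)"
      by (rule LIMSEQ_le_const2[OF lim]) (use le in blast)
    then show ?thesis
      by (auto simp: L2_def intro: le_less_trans)
  qed
  show ?thesis
    using 1 2 cutoff_eqI[OF B, of "Phi g x" y]
    by (auto simp: spectral_integral_Phi[OF g])
qed

lemma Phi_comp:
  assumes "bounded_borel g" "bounded_borel h" "\<And>r. k r = g r * h r"
  shows "Phi g (Phi h x) = Phi k x"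
proof -
  have "k = (\<lambda>r. g r * h r)"
    using assms(3) by auto
  then show ?thesis
    using assms by (simp add: Phi_mult)
qed

lemma Phi_arg_scaleR: "bounded_borel g \<Longrightarrow> Phi g (c *\<^sub>R x) = c *\<^sub>R Phi g x"
  by (rule linear_scale[OF bounded_linear.linear[OF bounded_linear_Phi]])

lemma Phi_arg_diff: "bounded_borel g \<Longrightarrow> Phi g (x - y) = Phi g x - Phi g y"
  by (rule linear_diff[OF bounded_linear.linear[OF bounded_linear_Phi]])

lemma E_diff: "B \<in> sets borel \<Longrightarrow> E B (x - y) = E B x - E B y"
  using Phi_arg_diff[of "indicator B" x y] by (simp add: Phi_indicator bounded_borel_indicator)

lemma Phi_E:
  assumes "bounded_borel g" "B \<in> sets borel"
  shows "Phi g (E B x) = Phi (\<lambda>r. g r * indicator B r) x"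
    and "E B (Phi g x) = Phi (\<lambda>r. g r * indicator B r) x"
  using assms by (auto simp: Phi_indicator[symmetric] intro!: Phi_comp)

lemma Phi_cong_full:
  assumes "K \<in> sets borel" "E K x = x" "bounded_borel g" "bounded_borel h" "\<And>r. r \<in> K \<Longrightarrow> g r = h r"
  shows "Phi g x = Phi h x"
proof -
  have "(\<lambda>r. g r * indicator K r) = (\<lambda>r. h r * indicator K r)"
    using assms(5) by (auto simp: indicator_def)
  then show ?thesis
    using Phi_E(1)[OF assms(3,1), of x] Phi_E(1)[OF assms(4,1), of x] assms(2) by simp
qed

text \<open>Permits a change of the integrand off a set that carries E. Cutting off where both
  functions are bounded lets \<open>spectral_integral_iff\<close> be applied to both with the same
  projections.\<close>

lemma spectral_integral_cong_full:
  assumes "K \<in> sets borel" "\<And>x. E K x = x"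
    and [measurable]: "g \<in> borel_measurable borel" "h \<in> borel_measurable borel"
    and eq: "\<And>r. r \<in> K \<Longrightarrow> g r = h r"
  shows "spectral_integral E g = spectral_integral E h"
proof -
  let ?B = "\<lambda>n. {r. \<bar>g r\<bar> \<le> real n} \<inter> {r. \<bar>h r\<bar> \<le> real n}"
  have B: "exhausts ?B"
    by (intro exhausts_Int exhausts_level) auto
  have bd: "bounded_borel (\<lambda>r. g r * indicator (?B n) r)" "bounded_borel (\<lambda>r. h r * indicator (?B n) r)" for n
    by (rule bounded_borel_cutoff[where K="real n"]; force)+
  have *: "Phi (\<lambda>r. g r * indicator (?B n) r) x = Phi (\<lambda>r. h r * indicator (?B n) r) x" for n x
    by (rule Phi_cong_full[OF assms(1,2) bd]) (simp add: eq)
  have "spectral_integral E g x = Some y \<longleftrightarrow> spectral_integral E h x = Some y" for x y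
    using *
    by (simp add: spectral_integral_iff[OF assms(3) B bd(1)] spectral_integral_iff[OF assms(4) B bd(2)])
  then show ?thesis
    by (metis ext option.exhaust)
qed

text \<open>The form is the squared norm of the image of x under the integral of the bounded
  function sqrt g.\<close>

lemma Phi_nonneg:
  assumes g: "bounded_borel g" "\<And>r. 0 \<le> g r"
  shows "0 \<le> Re (cinner (Phi g x) x)"
proof -
  obtain K where K: "\<And>r. \<bar>g r\<bar> \<le> K"
    using bounded_borelE[OF g(1)] by blast
  have h: "bounded_borel (\<lambda>r. sqrt (g r))"
    using g K real_sqrt_le_mono[OF order_trans[OF abs_ge_self K]]
    by (auto simp: bounded_borel_def intro!: exI[of _ "sqrt K"])
  have "Phi g x = Phi (\<lambda>r. sqrt (g r)) (Phi (\<lambda>r. sqrt (g r)) x)"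
    by (rule Phi_comp[symmetric]) (use h g in auto)
  then show ?thesis
    by (simp add: Phi_sym[OF h] cinner_self)
qed

text \<open>Passes from E to ordinary measures, whose null sets are closed under arbitrary countable
  unions, disjoint or not.\<close>

lemma null_iff:
  assumes "B \<in> sets borel"
  shows "B \<in> null_sets (scalar_measure E x) \<longleftrightarrow> E B x = 0"
  using assms by (simp add: null_sets_def emeasure_scalar_measure E_norm)

lemma E_Compl:
  assumes "B \<in> sets borel"
  shows "E B x = 0 \<longleftrightarrow> E (- B) x = x"
  using E_Un[of B "- B" x] assms by auto

end

section \<open>The spectrum\<close>

locale spectral_operator = spectral_family E for E :: "real set \<Rightarrow> 'h::chilbert_space \<Rightarrow> 'h" +
  fixes A :: "'h \<rightharpoonup> 'h"
  assumes A_eq: "A = spectral_integral E (\<lambda>s. s)"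
begin

definition I :: "nat \<Rightarrow> real set" where "I n = {r. \<bar>r\<bar> \<le> real n}"

lemma exhausts_I: "exhausts I"
  using exhausts_level[of "\<lambda>r. r"] unfolding I_def by simp

lemma sets_I [measurable, simp]: "I n \<in> sets borel"
  using exhausts_I by (rule exhausts_sets)

lemma bounded_borel_I: "bounded_borel (\<lambda>r. r * indicator (I n) r)"
  by (rule bounded_borel_cutoff[where K="real n"]) (auto simp: I_def)

lemma A_iff: "A x = Some y \<longleftrightarrow> (\<forall>n. E (I n) y = Phi (\<lambda>r. r * indicator (I n) r) x)"
  unfolding A_eq by (intro spectral_integral_iff exhausts_I bounded_borel_I) simp

text \<open>Source of test vectors: the range of a spectral projection lies in the domain when the
  identity function is bounded on the set.\<close>

lemma A_E:
  assumes B: "B \<in> sets borel" and bd: "bounded_borel (\<lambda>r. r * indicator B r)"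
  shows "A (E B x) = Some (Phi (\<lambda>r. r * indicator B r) x)"
  unfolding A_iff
proof
  fix n
  show "E (I n) (Phi (\<lambda>r. r * indicator B r) x) = Phi (\<lambda>r. r * indicator (I n) r) (E B x)"
    by (simp add: Phi_E bd B bounded_borel_I mult.assoc mult.commute[of "indicator B _"])
qed

text \<open>The resolvent at z is \<open>Phi q\<close>, since q inverts r - z on a set that carries
  E. The fact \<open>right\<close> says that it maps into the domain and is a right inverse,
  \<open>left\<close> that it is a left inverse; the bound on q gives the norm estimate.\<close>

lemma resolvent_setI:
  assumes K: "K \<in> sets borel" "\<And>x. E K x = x" and q: "bounded_borel q"
    and inv: "\<And>r. r \<in> K \<Longrightarrow> q r * (r - z) = 1"
  shows "complex_of_real z \<in> resolvent_set A"
proof -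
  let ?f = "\<lambda>u. the (A u) - complex_of_real z *\<^sub>C u"
  have right: "A (Phi q y) = Some (y + z *\<^sub>R Phi q y)" for y
    unfolding A_iff
  proof
    fix n
    let ?i = "indicator (I n) :: real \<Rightarrow> real"
    have "E (I n) (y + z *\<^sub>R Phi q y) = Phi ?i y + z *\<^sub>R Phi (\<lambda>r. q r * ?i r) y"
      by (simp add: E_add E_scaleR Phi_E q Phi_indicator)
    also have "\<dots> = Phi (\<lambda>r. ?i r + z * (q r * ?i r)) y"
      by (subst Phi_add; (subst Phi_cmult)?) (auto intro!: q)
    also have "\<dots> = Phi (\<lambda>r. (r * ?i r) * q r) y"
    proof (rule Phi_cong_full[OF K])
      fix r assume "r \<in> K"
      then have "1 + z * q r = r * q r"
        using inv[of r] by (simp add: algebra_simps)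
      then show "?i r + z * (q r * ?i r) = (r * ?i r) * q r"
        by (auto split: split_indicator)
    qed (auto intro!: q bounded_borel_I)
    also have "\<dots> = Phi (\<lambda>r. r * ?i r) (Phi q y)"
      by (rule Phi_mult[OF bounded_borel_I q])
    finally show "E (I n) (y + z *\<^sub>R Phi q y) = Phi (\<lambda>r. r * ?i r) (Phi q y)" .
  qed
  have left: "Phi q (v - z *\<^sub>R u) = u" if "A u = Some v" for u v
  proof (rule cutoff_eqI[OF exhausts_I])
    fix n
    let ?i = "indicator (I n) :: real \<Rightarrow> real"
    have "E (I n) (Phi q (v - z *\<^sub>R u)) = Phi q (E (I n) v - z *\<^sub>R E (I n) u)"
      by (simp add: Phi_E q Phi_arg_diff Phi_arg_scaleR E_diff E_scaleR)
    also have "E (I n) v = Phi (\<lambda>r. r * ?i r) u"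
      using that by (simp add: A_iff)
    also have "Phi (\<lambda>r. r * ?i r) u - z *\<^sub>R E (I n) u = Phi (\<lambda>r. r * ?i r - z * ?i r) u"
      by (subst Phi_diff; (subst Phi_cmult)?) (auto intro!: bounded_borel_I simp: Phi_indicator)
    also have "Phi q \<dots> = Phi (\<lambda>r. q r * (r * ?i r - z * ?i r)) u"
      by (rule Phi_mult[symmetric]) (auto intro!: q bounded_borel_I)
    also have "\<dots> = Phi ?i u"
    proof (rule Phi_cong_full[OF K])
      fix r assume "r \<in> K"
      then show "q r * (r * ?i r - z * ?i r) = ?i r"
        using inv[of r] by (auto split: split_indicator)
    qed (auto intro!: q bounded_borel_I)
    finally show "E (I n) (Phi q (v - z *\<^sub>R u)) = E (I n) u"
      by (simp add: Phi_indicator)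
  qed
  obtain C where C: "\<And>r. \<bar>q r\<bar> \<le> C"
    using bounded_borelE[OF q] by blast
  have "bij_betw ?f (dom A) UNIV"
    by (rule bij_betw_byWitness[where f'="Phi q"]) (auto simp: scaleC_of_real left right)
  moreover have "norm u \<le> C * norm (?f u)" if "u \<in> dom A" for u
    using that left[of u] Phi_norm_le[OF q C, of "?f u"] by (auto simp: scaleC_of_real)
  ultimately show ?thesis
    by (auto simp: resolvent_set_def)
qed

text \<open>A vector u in the range of the projection onto (z - d, z + d) satisfies |Au - zu| \<le>
  d |u|, while the resolvent estimate says |u| \<le> C |Au - zu|. For small d both hold only for u =
  0.\<close>

lemma resolvent_gap:
  assumes "complex_of_real z \<in> resolvent_set A"
  obtains d where "0 < d" "\<And>x. E {z - d<..<z + d} x = 0"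
proof -
  obtain C where C: "\<And>u. u \<in> dom A \<Longrightarrow> norm u \<le> C * norm (the (A u) - complex_of_real z *\<^sub>C u)"
    using assms by (auto simp: resolvent_set_def)
  \<comment> \<open>Any positive d with |C| d < 1 serves. The absolute value is taken because the
    sign of C is unknown, and the 1 keeps the denominator positive.\<close>
  define d where "d = 1 / (\<bar>C\<bar> + 1)"
  have d: "0 < d" "\<bar>C\<bar> * d < 1"
    by (auto simp: d_def field_simps)
  have "E {z - d<..<z + d} x = 0" for x
  proof -
    let ?J = "{z - d<..<z + d}"
    let ?i = "indicator ?J :: real \<Rightarrow> real"
    define u where "u = E ?J x"
    have bd: "bounded_borel (\<lambda>r. r * ?i r)"
      by (rule bounded_borel_cutoff[where K="\<bar>z\<bar> + d"]) auto
    have Au: "A u = Some (Phi (\<lambda>r. r * ?i r) x)"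
      unfolding u_def using bd by (intro A_E) auto
    have "Phi (\<lambda>r. r * ?i r) x - z *\<^sub>R u = Phi (\<lambda>r. r * ?i r - z * ?i r) x"
      by (subst Phi_diff; (subst Phi_cmult)?) (auto intro!: bd simp: Phi_indicator u_def)
    also have "\<dots> = Phi (\<lambda>r. r * ?i r - z * ?i r) u"
      unfolding u_def
      by (subst Phi_E) (auto intro!: bd arg_cong[where f="\<lambda>f. Phi f x"] split: split_indicator)
    also have "norm \<dots> \<le> d * norm u"
      using d by (intro Phi_norm_le) (auto intro!: bd split: split_indicator)
    finally have *: "norm (Phi (\<lambda>r. r * ?i r) x - z *\<^sub>R u) \<le> d * norm u" .
    have "norm u \<le> C * norm (Phi (\<lambda>r. r * ?i r) x - z *\<^sub>R u)"
      using C[of u] Au by (auto simp: scaleC_of_real)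
    also have "\<dots> \<le> \<bar>C\<bar> * (d * norm u)"
      using * by (intro mult_mono) auto
    finally have "(1 - \<bar>C\<bar> * d) * norm u \<le> 0"
      by (simp add: algebra_simps)
    then show ?thesis
      using d by (simp add: mult_le_0_iff u_def)
  qed
  with d that show ?thesis by blast
qed

text \<open>Every z' in the gap around z keeps a positive distance from the complement of the gap.
  That complement carries E, and 1 / (r - z') is bounded on it, so \<open>resolvent_setI\<close>
  applies.\<close>

lemma resolvent_set_open_real: "open {z. complex_of_real z \<in> resolvent_set A}"
  unfolding open_dist
proof safe
  fix z assume "complex_of_real z \<in> resolvent_set A"
  then obtain d where d: "0 < d" "\<And>x. E {z - d<..<z + d} x = 0"
    using resolvent_gap by blast
  have "complex_of_real z' \<in> resolvent_set A" if "dist z' z < d" for z'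
  proof (rule resolvent_setI)
    let ?K = "- {z - d<..<z + d}"
    let ?e = "d - dist z' z"
    show "?K \<in> sets borel" by simp
    show "E ?K x = x" for x
      using d(2)[of x] E_Compl[of "{z - d<..<z + d}" x] by simp
    have far: "?e \<le> \<bar>r - z'\<bar>" if "r \<in> ?K" for r
      using that unfolding dist_real_def by (simp add: not_less) linarith
    show "bounded_borel (\<lambda>r. 1 / (r - z') * indicator ?K r)"
    proof (rule bounded_borel_cutoff[where K="1 / ?e"])
      fix r assume "r \<in> ?K"
      then show "\<bar>1 / (r - z')\<bar> \<le> 1 / ?e"
        using far[of r] \<open>dist z' z < d\<close> by (auto simp: abs_divide intro!: divide_left_mono mult_pos_pos)
    qed auto
    show "1 / (r - z') * indicator ?K r * (r - z') = 1" if "r \<in> ?K" for r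
      using that far[of r] \<open>dist z' z < d\<close> by (auto simp del: indicator_simps simp: indicator_def)
  qed
  with d show "\<exists>e>0. \<forall>y. dist y z < e \<longrightarrow> y \<in> {z. complex_of_real z \<in> resolvent_set A}"
    by blast
qed

lemma real_spectrum_eq: "real_spectrum A = - {z. complex_of_real z \<in> resolvent_set A}"
  by (auto simp: real_spectrum_def spectrum_def)

lemma closed_real_spectrum: "closed (real_spectrum A)"
  using resolvent_set_open_real by (simp add: real_spectrum_eq closed_def)

text \<open>Each real point of the resolvent set has an open interval around it that E annihilates.
  By the Lindelof property countably many of these intervals suffice for the cover, and their union
  is null for every scalar measure.\<close>

lemma E_real_spectrum: "E (real_spectrum A) x = x"
proof -
  let ?R = "{z. complex_of_real z \<in> resolvent_set A}"
  define F where "F = {{z - d<..<z + d} | z d. 0 < d \<and> (\<forall>x. E {z - d<..<z + d} x = 0)}"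
  obtain F' where F': "F' \<subseteq> F" "countable F'" "\<Union>F' = \<Union>F"
    by (rule Lindelof[of F]) (auto simp: F_def)
  have "?R \<subseteq> \<Union>F"
  proof
    fix z assume "z \<in> ?R"
    then obtain d where "0 < d" "\<And>x. E {z - d<..<z + d} x = 0"
      using resolvent_gap[of z] by auto
    then have "{z - d<..<z + d} \<in> F" "z \<in> {z - d<..<z + d}"
      by (auto simp: F_def)
    then show "z \<in> \<Union>F" by blast
  qed
  moreover have "(\<Union>J\<in>F'. J) \<in> null_sets (scalar_measure E x)"
  proof (rule null_sets_UN'[OF F'(2)])
    fix J assume "J \<in> F'"
    then have "J \<in> F" using F'(1) by blast
    then have "J \<in> sets borel" "E J x = 0"
      by (auto simp: F_def)
    then show "J \<in> null_sets (scalar_measure E x)"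
      by (simp add: null_iff)
  qed
  moreover have R: "?R \<in> sets borel"
    using resolvent_set_open_real by (rule borel_open)
  ultimately have "?R \<in> null_sets (scalar_measure E x)"
    using F'(3) null_sets_subset[of "\<Union>F'" "scalar_measure E x" ?R] by simp
  then have "E ?R x = 0"
    using null_iff[OF R] by blast
  then show ?thesis
    using E_Compl[OF R] unfolding real_spectrum_eq by blast
qed

text \<open>For u in the spectral range below c / 2 the quadratic form is at most (c / 2) |u|^2, but
  by hypothesis at least c |u|^2. Halving c leaves a strict gap, which forces u = 0.\<close>

lemma E_below:
  assumes "0 < c" and pos: "\<And>u. u \<in> dom A \<Longrightarrow> c * (norm u)\<^sup>2 \<le> Re (cinner (the (A u)) u)"
  shows "E {..<c / 2} x = 0"
proof -
  \<comment> \<open>The lower end makes the identity function bounded on the interval, so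
    \<open>A_E\<close> provides vectors in the domain. The union over n then removes it.\<close>
  have "E {- real n..<c / 2} x = 0" for n
  proof -
    let ?J = "{- real n..<c / 2}"
    let ?i = "indicator ?J :: real \<Rightarrow> real"
    define u where "u = E ?J x"
    have bd: "bounded_borel (\<lambda>r. r * ?i r)"
      by (rule bounded_borel_cutoff[where K="real n + c"]) (use \<open>0 < c\<close> in auto)
    have Au: "A u = Some (Phi (\<lambda>r. r * ?i r) x)"
      unfolding u_def using bd by (intro A_E) auto
    have bd2: "bounded_borel (\<lambda>r. c / 2 * ?i r)"
      by (intro bounded_borel_mult bounded_borel_const bounded_borel_indicator) simp
    have bi: "bounded_borel ?i"
      by auto
    have Eu: "Phi ?i u = u"
      by (simp add: u_def Phi_indicator E_idem)
    have "Phi (\<lambda>r. r * ?i r) x = Phi (\<lambda>r. r * ?i r) u"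
      unfolding u_def
      by (subst Phi_E) (auto intro!: bd arg_cong[where f="\<lambda>f. Phi f x"] split: split_indicator)
    then have "c * (norm u)\<^sup>2 \<le> Re (cinner (Phi (\<lambda>r. r * ?i r) u) u)"
      using pos[of u] Au by auto
    moreover have "0 \<le> Re (cinner (Phi (\<lambda>r. c / 2 * ?i r - r * ?i r) u) u)"
      by (rule Phi_nonneg[OF bounded_borel_diff[OF bd2 bd]]) (auto split: split_indicator)
    moreover have "Phi (\<lambda>r. c / 2 * ?i r - r * ?i r) u = (c / 2) *\<^sub>R u - Phi (\<lambda>r. r * ?i r) u"
      by (simp only: Phi_diff[OF bd2 bd] Phi_cmult[OF bi] Eu)
    ultimately have "c * (norm u)\<^sup>2 \<le> c / 2 * (norm u)\<^sup>2"
      by (simp add: cinner.diff_left cinner_scaleR_left cinner_self)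
    then have "u = 0"
      using \<open>0 < c\<close> by simp
    then show ?thesis
      by (simp add: u_def)
  qed
  then have "(\<Union>n. {- real n..<c / 2}) \<in> null_sets (scalar_measure E x)"
    by (intro null_sets_UN') (auto simp: null_iff)
  moreover have "(\<Union>n. {- real n..<c / 2}) = {..<c / 2}"
  proof -
    have "\<exists>n. - real n \<le> r" for r
      using real_arch_simple[of "- r"] by (auto simp: minus_le_iff)
    then show ?thesis by auto
  qed
  ultimately show ?thesis
    using null_iff[of "{..<c / 2}" x] by simp
qed

end

section \<open>The exponential of the damped oscillator matrix\<close>

text \<open>Even and odd solution of \<open>y'' = z y\<close>.\<close>

definition gcos :: "real \<Rightarrow> real \<Rightarrow> real" where
  "gcos z t = (if z > 0 then cosh (sqrt z * t) else if z = 0 then 1 else cos (sqrt (- z) * t))"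

definition gsin :: "real \<Rightarrow> real \<Rightarrow> real" where
  "gsin z t = (if z > 0 then sinh (sqrt z * t) / sqrt z else if z = 0 then t
     else sin (sqrt (- z) * t) / sqrt (- z))"

lemma gcos_0 [simp]: "gcos z 0 = 1" and gsin_0 [simp]: "gsin z 0 = 0"
  by (auto simp: gcos_def gsin_def)

lemma gcos_add: "gcos z (s + t) = gcos z s * gcos z t + z * gsin z s * gsin z t"
  by (auto simp: gcos_def gsin_def distrib_left cosh_add cos_add)

lemma gsin_add: "gsin z (s + t) = gsin z s * gcos z t + gcos z s * gsin z t"
  by (auto simp: gcos_def gsin_def distrib_left sinh_add sin_add add_divide_distrib)

lemma has_derivative_gcos: "(gcos z has_real_derivative z * gsin z t) (at t)"
proof -
  consider "z > 0" | "z = 0" | "z < 0" by linarith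
  then show ?thesis
  proof cases
    case 1
    have "((\<lambda>t. cosh (sqrt z * t)) has_real_derivative z * (sinh (sqrt z * t) / sqrt z)) (at t)"
      using 1 by (auto intro!: derivative_eq_intros simp: real_div_sqrt field_simps)
    with 1 show ?thesis by (simp add: gcos_def[abs_def] gsin_def)
  next
    case 3
    define w where "w = sqrt (- z)"
    have w: "w \<noteq> 0" "z = - (w * w)"
      using 3 by (auto simp: w_def)
    have "((\<lambda>t. cos (w * t)) has_real_derivative z * (sin (w * t) / w)) (at t)"
      unfolding w(2) using w(1) by (auto intro!: derivative_eq_intros)
    with 3 show ?thesis by (simp add: gcos_def[abs_def] gsin_def w_def)
  qed (simp add: gcos_def[abs_def])
qed

lemma has_derivative_gsin: "(gsin z has_real_derivative gcos z t) (at t)"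
proof -
  consider "z > 0" | "z = 0" | "z < 0" by linarith
  then show ?thesis
  proof cases
    case 1
    have "((\<lambda>t. sinh (sqrt z * t) / sqrt z) has_real_derivative cosh (sqrt z * t)) (at t)"
      using 1 by (auto intro!: derivative_eq_intros simp: mult.assoc)
    with 1 show ?thesis by (simp add: gcos_def gsin_def[abs_def])
  next
    case 3
    define w where "w = sqrt (- z)"
    have "w \<noteq> 0"
      using 3 by (simp add: w_def)
    then have "((\<lambda>t. sin (w * t) / w) has_real_derivative cos (w * t)) (at t)"
      by (auto intro!: derivative_eq_intros)
    with 3 show ?thesis by (simp add: gcos_def gsin_def[abs_def] w_def)
  qed (simp add: gcos_def gsin_def[abs_def])
qed

text \<open>The entries of \<open>exp (t M) = [[e1, e2], [- e2, e3]]\<close> for \<open>M = [[0, p], [- p, - q]]\<close>: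
  with \<open>N = M + q / 2\<close> one has \<open>N\<^sup>2 = q\<^sup>2 / 4 - p\<^sup>2\<close>.\<close>

definition e1 :: "real \<Rightarrow> real \<Rightarrow> real \<Rightarrow> real" where
  "e1 p q t = exp (- (q / 2 * t)) * (gcos (q\<^sup>2 / 4 - p\<^sup>2) t + q / 2 * gsin (q\<^sup>2 / 4 - p\<^sup>2) t)"

definition e2 :: "real \<Rightarrow> real \<Rightarrow> real \<Rightarrow> real" where
  "e2 p q t = exp (- (q / 2 * t)) * (p * gsin (q\<^sup>2 / 4 - p\<^sup>2) t)"

definition e3 :: "real \<Rightarrow> real \<Rightarrow> real \<Rightarrow> real" where
  "e3 p q t = exp (- (q / 2 * t)) * (gcos (q\<^sup>2 / 4 - p\<^sup>2) t - q / 2 * gsin (q\<^sup>2 / 4 - p\<^sup>2) t)"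

lemma e_0 [simp]: "e1 p q 0 = 1" "e2 p q 0 = 0" "e3 p q 0 = 1"
  by (simp_all add: e1_def e2_def e3_def)

text \<open>The four entries of exp(sM) exp(tM). There are two formulas for \<open>e2\<close>
  because it occupies both off-diagonal places, up to sign.\<close>

lemma e_add:
  "e1 p q (s + t) = e1 p q s * e1 p q t - e2 p q s * e2 p q t"
  "e2 p q (s + t) = e1 p q s * e2 p q t + e2 p q s * e3 p q t"
  "e2 p q (s + t) = e2 p q s * e1 p q t + e3 p q s * e2 p q t"
  "e3 p q (s + t) = e3 p q s * e3 p q t - e2 p q s * e2 p q t"
  unfolding e1_def e2_def e3_def gcos_add gsin_add distrib_left minus_add_distrib exp_add
  by (simp_all add: algebra_simps power2_eq_square)

lemma e_derivative:
  "(e1 p q has_real_derivative - p * e2 p q t) (at t)"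
  "(e2 p q has_real_derivative p * e3 p q t) (at t)"
  "(e3 p q has_real_derivative - p * e2 p q t - q * e3 p q t) (at t)"
  unfolding e1_def[abs_def] e2_def[abs_def] e3_def[abs_def]
  by (rule derivative_eq_intros has_derivative_gcos has_derivative_gsin refl
      | simp add: algebra_simps power2_eq_square)+

text \<open>This is the commutation of M with exp(tM): the derivative of \<open>e2\<close> can be
  read from either off-diagonal entry of M exp(tM), as p e3 or as p e1 - q e2.\<close>

lemma e1_e3: "p * e1 p q t = p * e3 p q t + q * e2 p q t"
  by (simp add: e1_def e2_def e3_def algebra_simps)

lemma e_contraction:
  assumes "0 \<le> q" "0 \<le> t"
  shows "(e1 p q t * x + e2 p q t * y)\<^sup>2 + (- e2 p q t * x + e3 p q t * y)\<^sup>2 \<le> x\<^sup>2 + y\<^sup>2"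
proof -
  define X where "X t = e1 p q t * x + e2 p q t * y" for t
  define Y where "Y t = - e2 p q t * x + e3 p q t * y" for t
  have X: "(X has_real_derivative p * Y t) (at t)" for t
    unfolding X_def[abs_def] Y_def
    by (rule derivative_eq_intros e_derivative refl | simp add: algebra_simps)+
  have "(Y has_real_derivative - (p * e3 p q t) * x + (- p * e2 p q t - q * e3 p q t) * y) (at t)" for t
    unfolding Y_def[abs_def]
    by (rule derivative_eq_intros e_derivative refl | simp add: algebra_simps)+
  \<comment> \<open>Rewrites the derivative of Y as the second row of the system x' = M x; the
    commutation relation exchanges p e3 for p e1 - q e2.\<close>
  moreover have "- (p * e3 p q t) * x + (- p * e2 p q t - q * e3 p q t) * y = - p * X t - q * Y t" for t
    using arg_cong[OF e1_e3[of p q t], of "\<lambda>a. a * x"] by (simp add: X_def Y_def algebra_simps)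
  ultimately have Y: "(Y has_real_derivative - p * X t - q * Y t) (at t)" for t
    by simp
  have "((\<lambda>t. (X t)\<^sup>2 + (Y t)\<^sup>2) has_real_derivative - 2 * q * (Y t)\<^sup>2) (at t)" for t
    by (rule derivative_eq_intros X Y refl | simp add: algebra_simps power2_eq_square)+
  moreover have "- 2 * q * (Y t)\<^sup>2 \<le> 0" for t
    using assms by simp
  ultimately have "(X t)\<^sup>2 + (Y t)\<^sup>2 \<le> (X 0)\<^sup>2 + (Y 0)\<^sup>2"
    by (intro DERIV_nonpos_imp_nonincreasing[OF assms(2)]) blast
  then show ?thesis
    by (simp add: X_def Y_def)
qed

text \<open>The columns of a contraction are the images of unit vectors, hence have norm at most
  1.\<close>

lemma e_bounds:
  assumes "0 \<le> q" "0 \<le> t"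
  shows "\<bar>e1 p q t\<bar> \<le> 1" "\<bar>e2 p q t\<bar> \<le> 1" "\<bar>e3 p q t\<bar> \<le> 1"
proof -
  have "(e1 p q t)\<^sup>2 + (e2 p q t)\<^sup>2 \<le> 1" "(e2 p q t)\<^sup>2 + (e3 p q t)\<^sup>2 \<le> 1"
    using e_contraction[OF assms, of p 1 0] e_contraction[OF assms, of p 0 1] by simp_all
  then have "(e1 p q t)\<^sup>2 \<le> 1" "(e2 p q t)\<^sup>2 \<le> 1" "(e3 p q t)\<^sup>2 \<le> 1"
    using zero_le_power2[of "e1 p q t"] zero_le_power2[of "e2 p q t"] zero_le_power2[of "e3 p q t"]
    by linarith+
  then show "\<bar>e1 p q t\<bar> \<le> 1" "\<bar>e2 p q t\<bar> \<le> 1" "\<bar>e3 p q t\<bar> \<le> 1"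
    by (simp_all add: abs_square_le_1)
qed

lemma e_measurable:
  assumes [measurable]: "p \<in> borel_measurable borel" "q \<in> borel_measurable borel"
  shows "(\<lambda>r. e1 (p r) (q r) t) \<in> borel_measurable borel"
    "(\<lambda>r. e2 (p r) (q r) t) \<in> borel_measurable borel"
    "(\<lambda>r. e3 (p r) (q r) t) \<in> borel_measurable borel"
  unfolding e1_def e2_def e3_def gcos_def gsin_def cosh_field_def sinh_field_def
  by measurable

text \<open>The entries of \<open>(exp (t M) - 1) M\<^sup>-\<^sup>1\<close>, that is, of the integral of \<open>exp (s M)\<close> over \<open>[0, t]\<close>.\<close>

definition w11 :: "real \<Rightarrow> real \<Rightarrow> real \<Rightarrow> real" where
  "w11 p q t = (e2 p q t * p - (e1 p q t - 1) * q) / p\<^sup>2"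

definition w12 :: "real \<Rightarrow> real \<Rightarrow> real \<Rightarrow> real" where
  "w12 p q t = (1 - e1 p q t) / p"

definition w21 :: "real \<Rightarrow> real \<Rightarrow> real \<Rightarrow> real" where
  "w21 p q t = (e2 p q t * q + (e3 p q t - 1) * p) / p\<^sup>2"

definition w22 :: "real \<Rightarrow> real \<Rightarrow> real \<Rightarrow> real" where
  "w22 p q t = e2 p q t / p"

lemma w_measurable:
  assumes [measurable]: "p \<in> borel_measurable borel" "q \<in> borel_measurable borel"
  shows "(\<lambda>r. w11 (p r) (q r) t) \<in> borel_measurable borel"
    "(\<lambda>r. w12 (p r) (q r) t) \<in> borel_measurable borel"
    "(\<lambda>r. w21 (p r) (q r) t) \<in> borel_measurable borel"
    "(\<lambda>r. w22 (p r) (q r) t) \<in> borel_measurable borel"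
  unfolding w11_def w12_def w21_def w22_def
  by (intro borel_measurable_divide borel_measurable_add borel_measurable_diff borel_measurable_times
      borel_measurable_power e_measurable borel_measurable_const assms)+

lemma w_0 [simp]: "w11 p q 0 = 0" "w12 p q 0 = 0" "w21 p q 0 = 0" "w22 p q 0 = 0"
  by (simp_all add: w11_def w12_def w21_def w22_def)

lemma w_derivative:
  assumes "p \<noteq> 0"
  shows "(w11 p q has_real_derivative e1 p q t) (at t)"
    "(w12 p q has_real_derivative e2 p q t) (at t)"
    "(w21 p q has_real_derivative - e2 p q t) (at t)"
    "(w22 p q has_real_derivative e3 p q t) (at t)"
proof -
  have e: "e1 p q t = e3 p q t + q * e2 p q t / p"
    using e1_e3[of p q t] assms by (simp add: field_simps)
  show "(w11 p q has_real_derivative e1 p q t) (at t)"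
    unfolding w11_def[abs_def]
    by (rule derivative_eq_intros e_derivative refl | simp add: assms e field_simps power2_eq_square)+
  show "(w12 p q has_real_derivative e2 p q t) (at t)"
    unfolding w12_def[abs_def]
    by (rule derivative_eq_intros e_derivative refl | simp add: assms field_simps)+
  show "(w21 p q has_real_derivative - e2 p q t) (at t)"
    unfolding w21_def[abs_def]
    by (rule derivative_eq_intros e_derivative refl | simp add: assms field_simps power2_eq_square)+
  show "(w22 p q has_real_derivative e3 p q t) (at t)"
    unfolding w22_def[abs_def]
    by (rule derivative_eq_intros e_derivative refl | simp add: assms field_simps)+
qed

text \<open>By the mean value theorem the average is a value of e. This bounds the entries of Q(t)
  uniformly, although their formulas contain the unbounded q.\<close>

lemma average_le_1:
  fixes W :: "real \<Rightarrow> real"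
  assumes "\<And>t. (W has_real_derivative e t) (at t)" "W 0 = 0" "\<And>t. 0 \<le> t \<Longrightarrow> \<bar>e t\<bar> \<le> 1" "0 < t"
  shows "\<bar>W t / t\<bar> \<le> 1"
proof -
  obtain x where "0 < x" "W t - W 0 = (t - 0) * e x"
    using MVT2[OF assms(4), of W e] assms(1) by blast
  then have "W t / t = e x"
    using assms(2,4) by simp
  then show ?thesis
    using assms(3)[of x] \<open>0 < x\<close> by simp
qed

lemma average_tendsto:
  fixes W :: "real \<Rightarrow> real"
  assumes "\<And>t. (W has_real_derivative e t) (at t)" "W 0 = 0"
  shows "((\<lambda>t. W t / t) \<longlongrightarrow> e 0) (at_right 0)"
proof -
  have "((\<lambda>t. (W (0 + t) - W 0) / t) \<longlongrightarrow> e 0) (at 0)"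
    using assms(1)[of 0] by (simp add: DERIV_def)
  then show ?thesis
    using assms(2) by (auto intro: tendsto_mono[OF at_le])
qed

lemma psd_2x2:
  fixes p q r :: real
  assumes "\<And>x y. 0 \<le> p * x\<^sup>2 + 2 * q * x * y + r * y\<^sup>2"
  shows "0 \<le> p" "0 \<le> r" "q\<^sup>2 \<le> p * r"
proof -
  show p: "0 \<le> p" and "0 \<le> r"
    using assms[of 1 0] assms[of 0 1] by auto
  show "q\<^sup>2 \<le> p * r"
  proof (cases "p = 0")
    case True
    \<comment> \<open>With p = 0 the form takes the value -4 q^2 at this vector, so q = 0.\<close>
    have "0 \<le> - q\<^sup>2"
      using assms[of "- (r + 1)" "2 * q"] True by (simp add: algebra_simps power2_eq_square)
    with True show ?thesis by simp
  next
    case False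
    \<comment> \<open>The form at (q, -p) is p times the determinant.\<close>
    have "0 \<le> p * (p * r - q\<^sup>2)"
      using assms[of q "- p"] by (simp add: algebra_simps power2_eq_square)
    with False p show ?thesis by (simp add: zero_le_mult_iff)
  qed
qed

section \<open>Matrices of functions of the operator\<close>

context spectral_family
begin

definition Mat :: "(real \<Rightarrow> real) \<Rightarrow> (real \<Rightarrow> real) \<Rightarrow> (real \<Rightarrow> real) \<Rightarrow> (real \<Rightarrow> real) \<Rightarrow> 'h \<times> 'h \<Rightarrow> 'h \<times> 'h" where
  "Mat a b c d z = (Phi a (fst z) + Phi b (snd z), Phi c (fst z) + Phi d (snd z))"

definition Mat_bounded where
  "Mat_bounded a b c d \<longleftrightarrow> bounded_borel a \<and> bounded_borel b \<and> bounded_borel c \<and> bounded_borel d"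

text \<open>The entries of the product enter through pointwise equations, so that the right-hand
  side may be any convenient form of them.\<close>

lemma Mat_comp:
  assumes 1: "Mat_bounded a b c d" and 2: "Mat_bounded a' b' c' d'"
    and "\<And>r. k r = a r * a' r + b r * c' r" "\<And>r. l r = a r * b' r + b r * d' r"
    and "\<And>r. m r = c r * a' r + d r * c' r" "\<And>r. n r = c r * b' r + d r * d' r"
  shows "Mat a b c d (Mat a' b' c' d' z) = Mat k l m n z"
proof -
  have "k = (\<lambda>r. a r * a' r + b r * c' r)" "l = (\<lambda>r. a r * b' r + b r * d' r)"
    "m = (\<lambda>r. c r * a' r + d r * c' r)" "n = (\<lambda>r. c r * b' r + d r * d' r)"
    using assms by auto
  then show ?thesis
    using 1 2 by (simp add: Mat_def Mat_bounded_def Phi_linear Phi_add Phi_mult bounded_borel_mult)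
qed

lemma Mat_clinear:
  assumes "Mat_bounded a b c d"
  shows "clinear_on UNIV (Mat a b c d)"
  using assms
  by (simp add: clinear_on_def Mat_def Mat_bounded_def Phi_linear scaleC_prod_def scaleC_add_right)

lemma bounded_linear_Mat:
  assumes "Mat_bounded a b c d"
  shows "bounded_linear (Mat a b c d)"
  using assms unfolding Mat_def[abs_def] Mat_bounded_def
  by (intro bounded_linear_Pair bounded_linear_add bounded_linear_compose[OF bounded_linear_Phi]
      bounded_linear_fst bounded_linear_snd) auto

lemma Mat_tendsto:
  assumes "\<And>n. Mat_bounded (a n) (b n) (c n) (d n)" "Mat_bounded a' b' c' d'"
    and "\<And>n r. \<bar>a n r\<bar> \<le> 1" "\<And>n r. \<bar>b n r\<bar> \<le> 1" "\<And>n r. \<bar>c n r\<bar> \<le> 1" "\<And>n r. \<bar>d n r\<bar> \<le> 1"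
    and "\<And>r. (\<lambda>n. a n r) \<longlonglongrightarrow> a' r" "\<And>r. (\<lambda>n. b n r) \<longlonglongrightarrow> b' r"
    and "\<And>r. (\<lambda>n. c n r) \<longlonglongrightarrow> c' r" "\<And>r. (\<lambda>n. d n r) \<longlonglongrightarrow> d' r"
  shows "(\<lambda>n. Mat (a n) (b n) (c n) (d n) z) \<longlonglongrightarrow> Mat a' b' c' d' z"
  using assms unfolding Mat_def Mat_bounded_def
  by (intro tendsto_Pair tendsto_add Phi_tendsto[where K=1]) auto

text \<open>Completes the square pointwise: with h = sqrt p and k = q / h one has p = h^2, q = h k
  and k^2 \<le> r, so the expression dominates the squared norm of
  \<open>Phi h u + Phi k v\<close>.\<close>

lemma Phi_psd:
  assumes bd: "bounded_borel p" "bounded_borel q" "bounded_borel r"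
    and pos: "\<And>s. 0 \<le> p s" "\<And>s. 0 \<le> r s" "\<And>s. (q s)\<^sup>2 \<le> p s * r s"
  shows "0 \<le> Re (cinner (Phi p u) u) + 2 * Re (cinner (Phi q u) v) + Re (cinner (Phi r v) v)"
proof -
  define h where "h s = sqrt (p s)" for s
  \<comment> \<open>Where p vanishes, q^2 \<le> p r forces q = 0, so the value 0 still gives q = k
    h.\<close>
  define k where "k s = (if p s = 0 then 0 else q s / sqrt (p s))" for s
  have [measurable]: "p \<in> borel_measurable borel" "q \<in> borel_measurable borel" "r \<in> borel_measurable borel"
    using bd by (auto simp: bounded_borel_def)
  have kk: "k s * k s \<le> r s" for s
    using pos[of s] by (auto simp: k_def power2_eq_square divide_le_eq mult.commute)
  have hh: "p s = h s * h s" and hk: "q s = k s * h s" for s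
    using pos[of s] by (auto simp: h_def k_def)
  obtain P where P: "\<And>s. \<bar>p s\<bar> \<le> P"
    using bounded_borelE[OF bd(1)] by blast
  have "\<bar>h s\<bar> \<le> sqrt P" for s
    using P[of s] pos(1)[of s] by (simp add: h_def)
  then have h: "bounded_borel h"
    unfolding bounded_borel_def by (auto simp: h_def[abs_def])
  obtain R where R: "\<And>s. \<bar>r s\<bar> \<le> R"
    using bounded_borelE[OF bd(3)] by blast
  have "\<bar>k s\<bar> \<le> sqrt R" for s
    using order_trans[OF kk[of s] abs_le_D1[OF R]] real_sqrt_le_mono[of "k s * k s" R] by simp
  moreover have "k \<in> borel_measurable borel"
    unfolding k_def[abs_def] by measurable
  ultimately have k: "bounded_borel k"
    unfolding bounded_borel_def by auto
  have "0 \<le> (norm (Phi h u + Phi k v))\<^sup>2"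
    by simp
  also have "\<dots> = Re (cinner (Phi p u) u) + Re (cinner (Phi (\<lambda>s. k s * k s) v) v) + 2 * Re (cinner (Phi q u) v)"
    unfolding norm_add_sq Phi_comp[OF h h hh, symmetric] Phi_comp[OF k h hk, symmetric] Phi_mult[OF k k]
    by (simp add: Phi_sym[OF h, of "Phi h u" u] Phi_sym[OF k, of "Phi k v" v] Phi_sym[OF k, of "Phi h u" v] cinner_self)
  also have "Re (cinner (Phi (\<lambda>s. k s * k s) v) v) \<le> Re (cinner (Phi r v) v)"
    using Phi_nonneg[of "\<lambda>s. r s - k s * k s" v] kk bd k
    by (simp add: Phi_diff bounded_borel_mult bounded_borel_diff cinner.diff_left)
  finally show ?thesis by simp
qed

text \<open>The defect |z|^2 - |Mz|^2 is the quadratic form of 1 - M^T M. Contractivity on R^2 makes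
  this real matrix positive semidefinite at every s, and \<open>Phi_psd\<close> lifts that to H x
  H.\<close>

lemma Mat_norm_le:
  assumes bd: "Mat_bounded a b c d"
    and contr: "\<And>s x y. (a s * x + b s * y)\<^sup>2 + (c s * x + d s * y)\<^sup>2 \<le> x\<^sup>2 + y\<^sup>2"
  shows "norm (Mat a b c d z) \<le> norm z"
proof -
  \<comment> \<open>The functions p, q, r are the entries of 1 - M^T M.\<close>
  define p where "p s = 1 - a s * a s - c s * c s" for s
  define q where "q s = - (b s * a s) - d s * c s" for s
  define r where "r s = 1 - b s * b s - d s * d s" for s
  obtain u v where z: "z = (u, v)"
    by (cases z)
  have bb: "bounded_borel a" "bounded_borel b" "bounded_borel c" "bounded_borel d"
    using bd by (auto simp: Mat_bounded_def)
  have "0 \<le> p s * x\<^sup>2 + 2 * q s * x * y + r s * y\<^sup>2" for s x y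
    using contr[of s x y] by (simp add: p_def q_def r_def power2_eq_square algebra_simps)
  note psd = psd_2x2[OF this]
  have bpqr: "bounded_borel p" "bounded_borel q" "bounded_borel r"
    unfolding p_def[abs_def] q_def[abs_def] r_def[abs_def]
    by (intro bounded_borel_diff bounded_borel_minus bounded_borel_mult bounded_borel_const bb)+
  have sq: "cinner (Phi (\<lambda>s. g s * h s) u) v = cinner (Phi h u) (Phi g v)"
    if "bounded_borel g" "bounded_borel h" for g h u v
    using that by (simp add: Phi_mult Phi_sym)
  have P: "Re (cinner (Phi p u) u) = (norm u)\<^sup>2 - (norm (Phi a u))\<^sup>2 - (norm (Phi c u))\<^sup>2"
    unfolding p_def[abs_def] using bb
    by (simp add: Phi_diff bounded_borel_diff bounded_borel_mult bounded_borel_const Phi_one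
        cinner.diff_left sq cinner_self)
  have Q: "Re (cinner (Phi q u) v) = - Re (cinner (Phi a u) (Phi b v)) - Re (cinner (Phi c u) (Phi d v))"
    unfolding q_def[abs_def] using bb
    by (simp add: Phi_diff Phi_minus bounded_borel_diff bounded_borel_minus bounded_borel_mult
        cinner.diff_left cinner.minus_left sq)
  have R: "Re (cinner (Phi r v) v) = (norm v)\<^sup>2 - (norm (Phi b v))\<^sup>2 - (norm (Phi d v))\<^sup>2"
    unfolding r_def[abs_def] using bb
    by (simp add: Phi_diff bounded_borel_diff bounded_borel_mult bounded_borel_const Phi_one
        cinner.diff_left sq cinner_self)
  have "(norm (Phi a u + Phi b v))\<^sup>2 + (norm (Phi c u + Phi d v))\<^sup>2 \<le> (norm u)\<^sup>2 + (norm v)\<^sup>2"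
    using Phi_psd[OF bpqr psd, of u v] unfolding norm_add_sq P Q R by simp
  then show ?thesis
    by (simp add: z Mat_def norm_prod_def)
qed

end

section \<open>The damped wave semigroup\<close>

text \<open>Here \<open>p\<close> and \<open>q\<close> stand for sqrt s and f(s), already modified
  off the spectrum so that the bounds hold on the whole line.\<close>

locale damped_wave = spectral_family E for E :: "real set \<Rightarrow> 'h::chilbert_space \<Rightarrow> 'h" +
  fixes p q :: "real \<Rightarrow> real" and \<kappa> :: real
  assumes p_measurable [measurable]: "p \<in> borel_measurable borel"
    and q_measurable [measurable]: "q \<in> borel_measurable borel"
    and \<kappa>_pos: "0 < \<kappa>" and p_ge: "\<And>r. \<kappa> \<le> p r" and q_nonneg: "\<And>r. 0 \<le> q r"
begin

lemma p_pos [simp]: "0 < p r" "p r \<noteq> 0"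
  using p_ge[of r] \<kappa>_pos by auto

definition T :: "real \<Rightarrow> 'h \<times> 'h \<Rightarrow> 'h \<times> 'h" where
  "T t = Mat (\<lambda>r. e1 (p r) (q r) t) (\<lambda>r. e2 (p r) (q r) t) (\<lambda>r. - e2 (p r) (q r) t) (\<lambda>r. e3 (p r) (q r) t)"

definition Q :: "real \<Rightarrow> 'h \<times> 'h \<Rightarrow> 'h \<times> 'h" where
  "Q t = Mat (\<lambda>r. w11 (p r) (q r) t / t) (\<lambda>r. w12 (p r) (q r) t / t)
     (\<lambda>r. w21 (p r) (q r) t / t) (\<lambda>r. w22 (p r) (q r) t / t)"

definition B :: "nat \<Rightarrow> real set" where
  "B n = {r. \<bar>p r\<bar> \<le> real n} \<inter> {r. \<bar>q r\<bar> \<le> real n}"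

definition P :: "nat \<Rightarrow> 'h \<times> 'h \<Rightarrow> 'h \<times> 'h" where
  "P n = Mat (indicator (B n)) (\<lambda>_. 0) (\<lambda>_. 0) (indicator (B n))"

text \<open>The bounded operator P_n M.\<close>

definition G :: "nat \<Rightarrow> 'h \<times> 'h \<Rightarrow> 'h \<times> 'h" where
  "G n = Mat (\<lambda>_. 0) (\<lambda>r. p r * indicator (B n) r) (\<lambda>r. - (p r * indicator (B n) r))
     (\<lambda>r. - (q r * indicator (B n) r))"

lemma exhausts_B: "exhausts B"
  unfolding B_def by (intro exhausts_Int exhausts_level) auto

lemma sets_B [measurable, simp]: "B n \<in> sets borel"
  using exhausts_B by (rule exhausts_sets)

lemma bounded_p: "bounded_borel (\<lambda>r. p r * indicator (B n) r)"
  and bounded_q: "bounded_borel (\<lambda>r. q r * indicator (B n) r)"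
  and bounded_p2: "bounded_borel (\<lambda>r. (p r)\<^sup>2 * indicator (B n) r)"
proof -
  show p: "bounded_borel (\<lambda>r. p r * indicator (B n) r)" and "bounded_borel (\<lambda>r. q r * indicator (B n) r)"
    by (rule bounded_borel_cutoff[where K="real n"]; auto simp: B_def)+
  have "(\<lambda>r. (p r)\<^sup>2 * indicator (B n) r) = (\<lambda>r. (p r * indicator (B n) r) * (p r * indicator (B n) r))"
    by (auto simp: indicator_def power2_eq_square)
  then show "bounded_borel (\<lambda>r. (p r)\<^sup>2 * indicator (B n) r)"
    using bounded_borel_mult[OF p p] by simp
qed

lemma bounded_e:
  assumes "0 \<le> t"
  shows "bounded_borel (\<lambda>r. e1 (p r) (q r) t)" "bounded_borel (\<lambda>r. e2 (p r) (q r) t)"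
    "bounded_borel (\<lambda>r. e3 (p r) (q r) t)"
  unfolding bounded_borel_def
  by (intro conjI e_measurable p_measurable q_measurable exI[of _ 1] allI e_bounds q_nonneg assms)+

lemma w_le_1:
  assumes "0 < t"
  shows "\<bar>w11 (p r) (q r) t / t\<bar> \<le> 1" "\<bar>w12 (p r) (q r) t / t\<bar> \<le> 1"
    "\<bar>w21 (p r) (q r) t / t\<bar> \<le> 1" "\<bar>w22 (p r) (q r) t / t\<bar> \<le> 1"
  by (rule average_le_1[OF w_derivative(1)] average_le_1[OF w_derivative(2)]
      average_le_1[OF w_derivative(3)] average_le_1[OF w_derivative(4)];
      simp add: assms e_bounds q_nonneg)+

lemma Mat_bounded_T: "0 \<le> t \<Longrightarrow> Mat_bounded (\<lambda>r. e1 (p r) (q r) t) (\<lambda>r. e2 (p r) (q r) t)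
    (\<lambda>r. - e2 (p r) (q r) t) (\<lambda>r. e3 (p r) (q r) t)"
  using bounded_e by (auto simp: Mat_bounded_def)

lemma Mat_bounded_Q:
  assumes "0 < t"
  shows "Mat_bounded (\<lambda>r. w11 (p r) (q r) t / t) (\<lambda>r. w12 (p r) (q r) t / t)
     (\<lambda>r. w21 (p r) (q r) t / t) (\<lambda>r. w22 (p r) (q r) t / t)"
  unfolding Mat_bounded_def bounded_borel_def
  by (intro conjI borel_measurable_divide borel_measurable_const w_measurable p_measurable q_measurable
      exI[of _ 1] allI w_le_1 assms)

lemma Mat_bounded_P: "Mat_bounded (indicator (B n)) (\<lambda>_. 0) (\<lambda>_. 0) (indicator (B n))"
  by (auto simp: Mat_bounded_def)

lemma Mat_bounded_G: "Mat_bounded (\<lambda>_. 0) (\<lambda>r. p r * indicator (B n) r)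
    (\<lambda>r. - (p r * indicator (B n) r)) (\<lambda>r. - (q r * indicator (B n) r))"
  unfolding Mat_bounded_def
  by (intro conjI bounded_borel_minus bounded_borel_const bounded_p bounded_q)

lemma P_eq: "P n z = (E (B n) (fst z), E (B n) (snd z))"
  by (simp add: P_def Mat_def Phi_zero Phi_indicator)

lemma G_eq: "G n z = (Phi (\<lambda>r. p r * indicator (B n) r) (snd z),
    - Phi (\<lambda>r. p r * indicator (B n) r) (fst z) - Phi (\<lambda>r. q r * indicator (B n) r) (snd z))"
  by (simp add: G_def Mat_def Phi_zero Phi_minus bounded_p bounded_q)

lemma Mat_one: "Mat (\<lambda>_. 1) (\<lambda>_. 0) (\<lambda>_. 0) (\<lambda>_. 1) z = z"
  by (simp add: Mat_def Phi_zero Phi_one)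

section \<open>The semigroup and its averages\<close>

lemma T_0: "T 0 z = z"
  by (simp add: T_def Mat_one)

lemma T_add:
  assumes "0 \<le> s" "0 \<le> t"
  shows "T (s + t) z = T s (T t z)"
  unfolding T_def
proof (rule Mat_comp[OF Mat_bounded_T[OF assms(1)] Mat_bounded_T[OF assms(2)], symmetric])
  show "- e2 (p r) (q r) (s + t) =
      - e2 (p r) (q r) s * e1 (p r) (q r) t + e3 (p r) (q r) s * - e2 (p r) (q r) t" for r
    by (simp add: e_add(3))
qed (simp_all add: e_add(1,2,4))

lemma T_norm_le: "0 \<le> t \<Longrightarrow> norm (T t z) \<le> norm z"
  unfolding T_def using q_nonneg by (intro Mat_norm_le Mat_bounded_T e_contraction) auto

lemma e_tendsto:
  assumes "X \<longlonglongrightarrow> 0"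
  shows "(\<lambda>n. e1 a b (X n)) \<longlonglongrightarrow> 1" "(\<lambda>n. e2 a b (X n)) \<longlonglongrightarrow> 0" "(\<lambda>n. e3 a b (X n)) \<longlonglongrightarrow> 1"
  using isCont_tendsto_compose[OF DERIV_isCont[OF e_derivative(1)] assms, of a b]
    isCont_tendsto_compose[OF DERIV_isCont[OF e_derivative(2)] assms, of a b]
    isCont_tendsto_compose[OF DERIV_isCont[OF e_derivative(3)] assms, of a b]
  by simp_all

text \<open>The one-sided limit is tested on sequences, because \<open>Mat_tendsto\<close> rests on
  dominated convergence.\<close>

lemma T_continuous: "((\<lambda>t. T t z) \<longlongrightarrow> z) (at_right 0)"
  unfolding tendsto_at_iff_sequentially comp_def
proof (intro allI impI)
  fix X :: "nat \<Rightarrow> real" assume X: "\<forall>i. X i \<in> {0<..} - {0}" "X \<longlonglongrightarrow> 0"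
  then have pos: "0 \<le> X n" for n
    by (simp add: less_imp_le)
  have "(\<lambda>n. T (X n) z) \<longlonglongrightarrow> Mat (\<lambda>_. 1) (\<lambda>_. 0) (\<lambda>_. 0) (\<lambda>_. 1) z"
    unfolding T_def using pos e_tendsto(2)[OF X(2), THEN tendsto_minus]
    by (intro Mat_tendsto Mat_bounded_T e_tendsto X) (auto simp: Mat_bounded_def e_bounds q_nonneg)
  then show "(\<lambda>n. T (X n) z) \<longlonglongrightarrow> z"
    by (simp add: Mat_one)
qed

lemma contraction_semigroup_T: "contraction_semigroup UNIV norm T"
proof -
  have "((\<lambda>t. norm (T t z - z)) \<longlongrightarrow> 0) (at_right 0)" for z
    using T_continuous[of z] by (simp add: LIM_zero_iff tendsto_norm_zero_iff)
  then show ?thesis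
    by (auto simp: contraction_semigroup_def T_0 T_add T_norm_le) (simp add: T_def Mat_clinear Mat_bounded_T)
qed

lemma w_tendsto:
  assumes "filterlim X (at_right 0) sequentially" "a \<noteq> 0"
  shows "(\<lambda>n. w11 a b (X n) / X n) \<longlonglongrightarrow> 1" "(\<lambda>n. w12 a b (X n) / X n) \<longlonglongrightarrow> 0"
    "(\<lambda>n. w21 a b (X n) / X n) \<longlonglongrightarrow> 0" "(\<lambda>n. w22 a b (X n) / X n) \<longlonglongrightarrow> 1"
  using filterlim_compose[OF average_tendsto[OF w_derivative(1)[OF assms(2)]] assms(1)]
    filterlim_compose[OF average_tendsto[OF w_derivative(2)[OF assms(2)]] assms(1)]
    filterlim_compose[OF average_tendsto[OF w_derivative(3)[OF assms(2)]] assms(1)]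
    filterlim_compose[OF average_tendsto[OF w_derivative(4)[OF assms(2)]] assms(1)]
  by simp_all

lemma Q_continuous: "((\<lambda>t. Q t z) \<longlongrightarrow> z) (at_right 0)"
  unfolding tendsto_at_iff_sequentially comp_def
proof (intro allI impI)
  fix X :: "nat \<Rightarrow> real" assume X: "\<forall>i. X i \<in> {0<..} - {0}" "X \<longlonglongrightarrow> 0"
  then have pos: "0 < X n" for n
    by simp
  have X': "filterlim X (at_right 0) sequentially"
    using X(2) pos less_imp_neq[OF pos] by (auto simp: filterlim_at)
  have "(\<lambda>n. Q (X n) z) \<longlonglongrightarrow> Mat (\<lambda>_. 1) (\<lambda>_. 0) (\<lambda>_. 0) (\<lambda>_. 1) z"
    unfolding Q_def
    by (intro Mat_tendsto Mat_bounded_Q w_tendsto X' w_le_1 pos p_pos) (auto simp: Mat_bounded_def)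
  then show "(\<lambda>n. Q (X n) z) \<longlonglongrightarrow> z"
    by (simp add: Mat_one)
qed

lemma P_difference_quotient:
  assumes "0 < t"
  shows "P n ((1 / t) *\<^sub>R (T t z - z)) = Q t (G n z)"
proof -
  have b: "bounded_borel (\<lambda>r. e1 (p r) (q r) t - 1)" "bounded_borel (\<lambda>r. e2 (p r) (q r) t)"
    "bounded_borel (\<lambda>r. - e2 (p r) (q r) t)" "bounded_borel (\<lambda>r. e3 (p r) (q r) t - 1)"
    using bounded_e[of t] assms by auto
  have 1: "(1 / t) *\<^sub>R (T t z - z) = Mat (\<lambda>r. (1 / t) * (e1 (p r) (q r) t - 1)) (\<lambda>r. (1 / t) * e2 (p r) (q r) t)
      (\<lambda>r. (1 / t) * (- e2 (p r) (q r) t)) (\<lambda>r. (1 / t) * (e3 (p r) (q r) t - 1)) z"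
    unfolding Mat_def Phi_cmult[OF b(1)] Phi_cmult[OF b(2)] Phi_cmult[OF b(3)] Phi_cmult[OF b(4)]
    using bounded_e[of t] assms
    by (simp add: T_def Mat_def Phi_diff Phi_one bounded_borel_const prod_eq_iff algebra_simps)
  have bd: "Mat_bounded (\<lambda>r. (1 / t) * (e1 (p r) (q r) t - 1)) (\<lambda>r. (1 / t) * e2 (p r) (q r) t)
      (\<lambda>r. (1 / t) * (- e2 (p r) (q r) t)) (\<lambda>r. (1 / t) * (e3 (p r) (q r) t - 1))"
    unfolding Mat_bounded_def by (intro conjI bounded_borel_mult bounded_borel_const b)
  \<comment> \<open>The entries, up to sign, of W M = exp(tM) - 1, where W is the integral of
    exp(sM) over [0, t].\<close>
  have key: "p r * w12 (p r) (q r) t = 1 - e1 (p r) (q r) t"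
    "p r * w11 (p r) (q r) t - q r * w12 (p r) (q r) t = e2 (p r) (q r) t"
    "p r * w22 (p r) (q r) t = e2 (p r) (q r) t"
    "p r * w21 (p r) (q r) t - q r * w22 (p r) (q r) t = e3 (p r) (q r) t - 1" for r
    by (simp_all add: w11_def w12_def w21_def w22_def power2_eq_square field_simps)
  let ?i = "\<lambda>r. indicator (B n) r / t"
  have "P n ((1 / t) *\<^sub>R (T t z - z)) = Mat (\<lambda>r. ?i r * (e1 (p r) (q r) t - 1)) (\<lambda>r. ?i r * e2 (p r) (q r) t)
      (\<lambda>r. - (?i r * e2 (p r) (q r) t)) (\<lambda>r. ?i r * (e3 (p r) (q r) t - 1)) z"
    unfolding 1 P_def by (rule Mat_comp[OF Mat_bounded_P bd]) auto
  also have "\<dots> = Q t (G n z)"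
    unfolding Q_def G_def
  proof (rule Mat_comp[OF Mat_bounded_Q[OF assms] Mat_bounded_G, symmetric])
    fix r
    have "e1 (p r) (q r) t - 1 = - (p r * w12 (p r) (q r) t)"
      by (simp add: key)
    then show "?i r * (e1 (p r) (q r) t - 1) =
        w11 (p r) (q r) t / t * 0 + w12 (p r) (q r) t / t * - (p r * indicator (B n) r)"
      by simp
    show "?i r * e2 (p r) (q r) t = w11 (p r) (q r) t / t * (p r * indicator (B n) r) +
        w12 (p r) (q r) t / t * - (q r * indicator (B n) r)"
      unfolding key(2)[symmetric] using assms by (simp add: field_simps)
    show "- (?i r * e2 (p r) (q r) t) = w21 (p r) (q r) t / t * 0 + w22 (p r) (q r) t / t * - (p r * indicator (B n) r)"
      unfolding key(3)[symmetric] using assms by (simp add: field_simps)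
    show "?i r * (e3 (p r) (q r) t - 1) = w21 (p r) (q r) t / t * (p r * indicator (B n) r) +
        w22 (p r) (q r) t / t * - (q r * indicator (B n) r)"
      unfolding key(4)[symmetric] using assms by (simp add: field_simps)
  qed
  finally show ?thesis .
qed

lemma P_Q_commute: "0 < t \<Longrightarrow> Q t (P n z) = P n (Q t z)"
  unfolding Q_def P_def
  by (subst (1 2) Mat_comp[OF _ _ refl refl refl refl])
    (auto simp: Mat_bounded_Q Mat_bounded_P mult.commute)

lemma P_eqI: "(\<And>n. P n y = P n z) \<Longrightarrow> y = z"
  by (auto simp: P_eq prod_eq_iff intro: cutoff_eqI[OF exhausts_B])

lemma generator_iff:
  "((\<lambda>t. (1 / t) *\<^sub>R (T t z - z)) \<longlongrightarrow> y) (at_right 0) \<longleftrightarrow> (\<forall>n. P n y = G n z)"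
proof
  assume lim: "((\<lambda>t. (1 / t) *\<^sub>R (T t z - z)) \<longlongrightarrow> y) (at_right 0)"
  show "\<forall>n. P n y = G n z"
  proof
    fix n
    have "((\<lambda>t. P n ((1 / t) *\<^sub>R (T t z - z))) \<longlongrightarrow> P n y) (at_right 0)"
      unfolding P_def by (rule bounded_linear.tendsto[OF bounded_linear_Mat[OF Mat_bounded_P] lim])
    moreover have "eventually (\<lambda>t. P n ((1 / t) *\<^sub>R (T t z - z)) = Q t (G n z)) (at_right 0)"
      using eventually_at_right_less[of 0] by eventually_elim (rule P_difference_quotient)
    ultimately have "((\<lambda>t. Q t (G n z)) \<longlongrightarrow> P n y) (at_right 0)"
      by (rule Lim_transform_eventually)
    then show "P n y = G n z"
      using Q_continuous[of "G n z"] by (intro tendsto_unique[of "at_right (0::real)"]) auto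
  qed
next
  assume y: "\<forall>n. P n y = G n z"
  \<comment> \<open>Under every \<open>P n\<close> both sides become \<open>Q t (G n z)\<close>. So
    the difference quotient is exactly an average of the orbit of y, and it converges because the
    averages do.\<close>
  have eq: "Q t y = (1 / t) *\<^sub>R (T t z - z)" if "0 < t" for t
    by (rule P_eqI) (use y that in \<open>simp add: P_difference_quotient P_Q_commute[symmetric]\<close>)
  have "eventually (\<lambda>t. Q t y = (1 / t) *\<^sub>R (T t z - z)) (at_right 0)"
    using eventually_at_right_less[of 0] by eventually_elim (rule eq)
  then show "((\<lambda>t. (1 / t) *\<^sub>R (T t z - z)) \<longlongrightarrow> y) (at_right 0)"
    by (rule Lim_transform_eventually[OF Q_continuous])
qed

section \<open>The square root of A and the sum defined by duality\<close>

abbreviation "Ah \<equiv> spectral_integral E p"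

text \<open>The bounded inverse of A^(1/2).\<close>

definition J :: "'h \<Rightarrow> 'h" where
  "J = Phi (\<lambda>r. 1 / p r)"

lemma bounded_J: "bounded_borel (\<lambda>r. 1 / p r)"
  unfolding bounded_borel_def
proof (intro conjI exI[of _ "1 / \<kappa>"] allI)
  show "\<bar>1 / p r\<bar> \<le> 1 / \<kappa>" for r
    using p_ge[of r] \<kappa>_pos by (simp add: abs_divide divide_left_mono)
qed measurable

lemma Ah_iff: "Ah x = Some y \<longleftrightarrow> (\<forall>n. E (B n) y = Phi (\<lambda>r. p r * indicator (B n) r) x)"
  by (intro spectral_integral_iff exhausts_B bounded_p p_measurable)

lemma F_iff: "spectral_integral E q x = Some y \<longleftrightarrow> (\<forall>n. E (B n) y = Phi (\<lambda>r. q r * indicator (B n) r) x)"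
  by (intro spectral_integral_iff exhausts_B bounded_q q_measurable)

lemma A_iff: "spectral_integral E (\<lambda>r. (p r)\<^sup>2) x = Some y \<longleftrightarrow>
    (\<forall>n. E (B n) y = Phi (\<lambda>r. (p r)\<^sup>2 * indicator (B n) r) x)"
  by (intro spectral_integral_iff exhausts_B bounded_p2) measurable

lemma Ah_J: "Ah (J U) = Some U"
  unfolding Ah_iff J_def
proof
  show "E (B n) U = Phi (\<lambda>r. p r * indicator (B n) r) (Phi (\<lambda>r. 1 / p r) U)" for n
    by (subst Phi_comp[OF bounded_p bounded_J, of "indicator (B n)"]) (auto simp: Phi_indicator)
qed

lemma J_Ah: "Ah u = Some U \<Longrightarrow> J U = u"
proof (rule cutoff_eqI[OF exhausts_B])
  fix n assume "Ah u = Some U"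
  then have "Phi (\<lambda>r. 1 / p r) (E (B n) U) = Phi (\<lambda>r. 1 / p r) (Phi (\<lambda>r. p r * indicator (B n) r) u)"
    by (simp add: Ah_iff)
  also have "\<dots> = Phi (indicator (B n)) u"
    by (rule Phi_comp[OF bounded_J bounded_p]) simp
  finally show "E (B n) (J U) = E (B n) u"
    by (simp add: J_def Phi_E bounded_J Phi_indicator)
qed

text \<open>Since u need not lie in the domain of A, only one factor A^(1/2) may act on it without a
  cutoff; the other stays inside the bounded integral.\<close>

lemma Phi_p2:
  assumes "Ah u = Some U"
  shows "Phi (\<lambda>r. (p r)\<^sup>2 * indicator (B n) r) u = Phi (\<lambda>r. p r * indicator (B n) r) U"
proof -
  have "Phi (\<lambda>r. (p r)\<^sup>2 * indicator (B n) r) u =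
      Phi (\<lambda>r. p r * indicator (B n) r) (Phi (\<lambda>r. p r * indicator (B n) r) u)"
    by (rule Phi_comp[OF bounded_p bounded_p, symmetric]) (simp add: indicator_def power2_eq_square)
  also have "\<dots> = Phi (\<lambda>r. p r * indicator (B n) r) (E (B n) U)"
    using assms by (simp add: Ah_iff)
  also have "\<dots> = Phi (\<lambda>r. p r * indicator (B n) r) U"
    by (subst Phi_E(1)[OF bounded_p sets_B]) (simp add: mult.assoc indicator_inter_arith[symmetric])
  finally show ?thesis .
qed

text \<open>One direction tests with cut-off vectors and moves the bounded operators across the
  inner product. For the other, the identities for h are paired with an arbitrary w of the common
  domain, and n tends to infinity.\<close>

lemma dual_sum_iff:
  assumes U: "Ah u = Some U"
  shows "is_dual_sum (spectral_integral E (\<lambda>r. (p r)\<^sup>2)) (spectral_integral E q) u v h \<longleftrightarrow>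
    (\<forall>n. E (B n) h = Phi (\<lambda>r. p r * indicator (B n) r) U + Phi (\<lambda>r. q r * indicator (B n) r) v)"
    (is "is_dual_sum ?A ?F u v h \<longleftrightarrow> (\<forall>n. _ = Phi (?p n) U + Phi (?q n) v)")
proof
  let ?p2 = "\<lambda>n r. (p r)\<^sup>2 * indicator (B n) r"
  assume dual: "is_dual_sum ?A ?F u v h"
  show "\<forall>n. E (B n) h = Phi (?p n) U + Phi (?q n) v"
  proof (intro allI cinner_left_eqI)
    fix n w
    \<comment> \<open>Both functions are bounded on \<open>B n\<close>, so the projected vector lies
      in both domains and is an admissible test vector.\<close>
    have "?A (E (B n) w) = Some (Phi (?p2 n) w)" "?F (E (B n) w) = Some (Phi (?q n) w)"
      unfolding A_iff F_iff
      by (simp_all add: Phi_E bounded_p2 bounded_q mult.assoc mult.commute[of "indicator (B n) _"])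
    then have "cinner (Phi (?p2 n) w) u + cinner (Phi (?q n) w) v = cinner (E (B n) w) h"
      using dual unfolding is_dual_sum_def by force
    then show "cinner w (E (B n) h) = cinner w (Phi (?p n) U + Phi (?q n) v)"
      by (simp add: Phi_sym bounded_p2 bounded_q E_sym cinner_add_right Phi_p2[OF U])
  qed
next
  let ?p2 = "\<lambda>n r. (p r)\<^sup>2 * indicator (B n) r"
  assume h: "\<forall>n. E (B n) h = Phi (?p n) U + Phi (?q n) v"
  show "is_dual_sum ?A ?F u v h"
    unfolding is_dual_sum_def
  proof
    fix w assume "w \<in> dom ?A \<inter> dom ?F"
    then obtain a b where ab: "?A w = Some a" "?F w = Some b" by blast
    have "cinner (E (B n) a) u + cinner (E (B n) b) v = cinner w (E (B n) h)" for n
      using ab h by (simp add: A_iff F_iff Phi_sym bounded_p2 bounded_q cinner_add_right Phi_p2[OF U])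
    moreover have "(\<lambda>n. cinner (E (B n) a) u + cinner (E (B n) b) v) \<longlonglongrightarrow> cinner a u + cinner b v"
      by (intro tendsto_add cinner.tendsto cutoff_tendsto exhausts_B tendsto_const)
    moreover have "(\<lambda>n. cinner w (E (B n) h)) \<longlonglongrightarrow> cinner w h"
      by (intro cinner.tendsto cutoff_tendsto exhausts_B tendsto_const)
    ultimately show "cinner (the (?A w)) u + cinner (the (?F w)) v = cinner w h"
      using ab by (simp add: LIMSEQ_unique)
  qed
qed

text \<open>Gives meaning to the \<open>THE\<close> in \<open>damped_operator\<close>: all cutoffs
  of h are prescribed.\<close>

lemma dual_sum_unique:
  assumes "Ah u = Some U" "is_dual_sum (spectral_integral E (\<lambda>r. (p r)\<^sup>2)) (spectral_integral E q) u v h"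
    "is_dual_sum (spectral_integral E (\<lambda>r. (p r)\<^sup>2)) (spectral_integral E q) u v h'"
  shows "h = h'"
proof (rule cutoff_eqI[OF exhausts_B])
  show "E (B n) h = E (B n) h'" for n
    using assms(2,3) unfolding dual_sum_iff[OF assms(1)] by metis
qed

end

section \<open>Transport of semigroups\<close>

text \<open>Linearity is available only on X and for sums and complex multiples. The single
  expression covers the difference quotient minus its limit as well as the plain increment.\<close>

lemma clinear_on_diff_quotient:
  fixes L :: "'x::complex_vector \<Rightarrow> 'y::complex_vector"
  assumes L: "clinear_on X L" and X: "x \<in> X" "y \<in> X" "z \<in> X"
  shows "r *\<^sub>R (x - y) - z \<in> X" "L (r *\<^sub>R (x - y) - z) = r *\<^sub>R (L x - L y) - L z"
proof -
  have scale: "c *\<^sub>R v \<in> X" "L (c *\<^sub>R v) = c *\<^sub>R L v" if "v \<in> X" for c v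
    using L that unfolding clinear_on_def by (metis scaleC_of_real)+
  have add: "v + w \<in> X" "L (v + w) = L v + L w" if "v \<in> X" "w \<in> X" for v w
    using L that unfolding clinear_on_def by blast+
  have diff: "v - w \<in> X" "L (v - w) = L v - L w" if "v \<in> X" "w \<in> X" for v w
    using add[OF that(1) scale(1)[OF that(2), of "-1"]] scale(2)[OF that(2), of "-1"] by simp_all
  show "r *\<^sub>R (x - y) - z \<in> X" "L (r *\<^sub>R (x - y) - z) = r *\<^sub>R (L x - L y) - L z"
    using X by (simp_all add: scale diff)
qed

text \<open>The phase space is a proper subset in general and has a norm of its own, so the
  semigroup is built on a full normed type and pulled back along the isometry L.\<close>

locale transported_semigroup =
  fixes X :: "'x::complex_vector set" and N :: "'x \<Rightarrow> real"
    and L :: "'x \<Rightarrow> 'y::{complex_vector, real_normed_vector}" and T :: "real \<Rightarrow> 'y \<Rightarrow> 'y"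
  assumes linear: "clinear_on X L" and bij: "bij_betw L X UNIV"
    and N_eq: "\<And>x. x \<in> X \<Longrightarrow> N x = norm (L x)"
    and semigroup: "contraction_semigroup UNIV norm T"
begin

definition S :: "real \<Rightarrow> 'x \<Rightarrow> 'x" where
  "S t x = inv_into X L (T t (L x))"

lemma S_in: "S t x \<in> X" and L_S: "L (S t x) = T t (L x)"
  using bij unfolding S_def bij_betw_def by (auto intro: inv_into_into f_inv_into_f)

lemma L_inj: "x \<in> X \<Longrightarrow> y \<in> X \<Longrightarrow> L x = L y \<Longrightarrow> x = y"
  using bij by (auto simp: bij_betw_def inj_on_def)

lemma N_diff_quotient:
  assumes "x \<in> X" "y \<in> X"
  shows "N (r *\<^sub>R (S t x - x) - y) = norm (r *\<^sub>R (T t (L x) - L x) - L y)"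
  using clinear_on_diff_quotient[OF linear S_in assms] by (simp add: N_eq L_S)

lemma contraction_semigroup_S: "contraction_semigroup X N S"
  unfolding contraction_semigroup_def
proof (intro conjI allI impI ballI)
  have lin: "0 \<in> X" "\<And>x y. x \<in> X \<Longrightarrow> y \<in> X \<Longrightarrow> x + y \<in> X \<and> L (x + y) = L x + L y"
    "\<And>c x. x \<in> X \<Longrightarrow> c *\<^sub>C x \<in> X \<and> L (c *\<^sub>C x) = c *\<^sub>C L x"
    using linear by (auto simp: clinear_on_def)
  have T: "\<And>t x y. 0 \<le> t \<Longrightarrow> T t (x + y) = T t x + T t y" "\<And>t c x. 0 \<le> t \<Longrightarrow> T t (c *\<^sub>C x) = c *\<^sub>C T t x"
    "\<And>t x. 0 \<le> t \<Longrightarrow> norm (T t x) \<le> norm x" "\<And>x. T 0 x = x"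
    "\<And>s t x. 0 \<le> s \<Longrightarrow> 0 \<le> t \<Longrightarrow> T (s + t) x = T s (T t x)"
    "\<And>x. ((\<lambda>t. norm (T t x - x)) \<longlongrightarrow> 0) (at_right 0)"
    using semigroup unfolding contraction_semigroup_def clinear_on_def by simp_all
  show "S t ` X \<subseteq> X" for t
    using S_in by blast
  show "clinear_on X (S t)" if "0 \<le> t" for t
    unfolding clinear_on_def
    using that by (auto simp: lin S_in L_S T intro!: L_inj)
  show "N (S t x) \<le> N x" if "0 \<le> t" "x \<in> X" for t x
    using that by (simp add: N_eq S_in L_S T)
  show "S 0 x = x" if "x \<in> X" for x
    using that by (intro L_inj) (simp_all add: S_in L_S T)
  show "S (s + t) x = S s (S t x)" if "0 \<le> s" "0 \<le> t" for s t x
    using that by (intro L_inj) (simp_all add: S_in L_S T)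
  show "((\<lambda>t. N (S t x - x)) \<longlongrightarrow> 0) (at_right 0)" if "x \<in> X" for x
    \<comment> \<open>The case r = 1, y = 0; that L 0 = 0 follows from additivity at 0 + 0.\<close>
    using N_diff_quotient[OF that lin(1), of 1] lin(2)[OF lin(1) lin(1)] T(6)[of "L x"]
    by simp
qed

lemma is_generator_S:
  assumes "\<And>x y. D x = Some y \<longleftrightarrow> x \<in> X \<and> y \<in> X \<and>
    ((\<lambda>t. (1 / t) *\<^sub>R (T t (L x) - L x)) \<longlongrightarrow> L y) (at_right 0)"
  shows "is_generator X N S D"
  unfolding is_generator_def assms
proof (intro allI conj_cong refl)
  fix x y assume "x \<in> X" "y \<in> X"
  then show "((\<lambda>t. (1 / t) *\<^sub>R (T t (L x) - L x)) \<longlongrightarrow> L y) (at_right 0) \<longleftrightarrow>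
      ((\<lambda>t. N ((1 / t) *\<^sub>R (S t x - x) - y)) \<longlongrightarrow> 0) (at_right 0)"
    by (simp only: N_diff_quotient tendsto_norm_zero_iff LIM_zero_iff)
qed

end

theorem theorem7p1:
  fixes A :: "'h::chilbert_space \<rightharpoonup> 'h"
    and E :: "real set \<Rightarrow> 'h \<Rightarrow> 'h"
    and f :: "real \<Rightarrow> real"
  assumes separable: "\<exists>D :: 'h set. countable D \<and> closure D = UNIV"
    and selfadjoint: "selfadjoint A"
    and positive: "strictly_positive A"
    and spectral_measure: "is_spectral_measure_of E A"
    and f_cont: "continuous_on (real_spectrum A) f"
    and f_nonneg: "\<forall>s\<in>real_spectrum A. 0 \<le> f s"
  shows "\<exists>S. contraction_semigroup (phase_space A E) (phase_norm A E) S \<and>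
             is_generator (phase_space A E) (phase_norm A E) S (damped_operator A E f)"
proof -
  interpret spectral_operator E A
    using spectral_measure by unfold_locales (auto simp: is_spectral_measure_of_def)
  obtain c where c: "0 < c" "\<And>u. u \<in> dom A \<Longrightarrow> c * (norm u)\<^sup>2 \<le> Re (cinner (the (A u)) u)"
    using positive by (auto simp: strictly_positive_def)
  \<comment> \<open>By \<open>E_real_spectrum\<close> and \<open>E_below\<close> this set carries E,
    and sqrt is bounded below on it.\<close>
  define K where "K = real_spectrum A \<inter> {c / 2..}"
  \<comment> \<open>The value 1 off K keeps p away from 0 everywhere, which is where the minimum
    with 1 in the lower bound below comes from.\<close>
  define p where "p r = (if r \<in> K then sqrt r else 1)" for r
  define q where "q r = indicator K r *\<^sub>R f r" for r
  have K_closed: "closed K"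
    unfolding K_def by (intro closed_Int closed_real_spectrum closed_atLeast)
  then have K_sets [measurable]: "K \<in> sets borel"
    by (rule borel_closed)
  have spec_sets [measurable]: "real_spectrum A \<in> sets borel"
    using closed_real_spectrum by (rule borel_closed)
  have E_K: "E K x = x" for x
  proof -
    have "E {c / 2..} x = x"
      using E_Compl[of "{..<c / 2}" x] E_below[OF c, of x] by (simp add: Compl_lessThan)
    then show ?thesis
      using closed_real_spectrum by (simp add: K_def E_Int E_real_spectrum borel_closed)
  qed
  have K_pos: "c / 2 \<le> r" "0 < r" if "r \<in> K" for r
    using that c(1) by (auto simp: K_def)
  interpret W: damped_wave E p q "min 1 (sqrt (c / 2))"
  proof unfold_locales
    show "p \<in> borel_measurable borel"
      unfolding p_def[abs_def] by measurable
    show "q \<in> borel_measurable borel"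
      unfolding q_def[abs_def] using K_def
      by (intro borel_measurable_continuous_on_indicator K_sets continuous_on_subset[OF f_cont]) auto
    show "min 1 (sqrt (c / 2)) \<le> p r" for r
      using K_pos(1)[of r] by (auto simp: p_def min_le_iff_disj)
    show "0 \<le> q r" for r
      using f_nonneg by (auto simp: q_def K_def indicator_def)
    show "0 < min 1 (sqrt (c / 2))"
      using c(1) by simp
  qed
  have A_p: "A = spectral_integral E (\<lambda>r. (p r)\<^sup>2)"
    unfolding A_eq by (rule spectral_integral_cong_full[OF K_sets E_K])
      (auto simp: p_def dest: K_pos(2))
  have F_q: "fun_calc A E f = spectral_integral E q"
    unfolding fun_calc_def
  proof (rule spectral_integral_cong_full[OF K_sets E_K])
    show "(\<lambda>s. indicator (real_spectrum A) s * f s) \<in> borel_measurable borel"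
      using borel_measurable_continuous_on_indicator[OF spec_sets f_cont] by simp
  qed (auto simp: q_def K_def W.q_measurable)
  have Ah_p: "frac_power A E (1 / 2) = spectral_integral E p"
    unfolding frac_power_def fun_calc_def
  proof (rule spectral_integral_cong_full[OF K_sets E_K])
    show "indicator (real_spectrum A) r * r powr (1 / 2) = p r" if "r \<in> K" for r
      using that K_pos(2)[OF that] by (simp add: p_def K_def powr_half_sqrt)
  qed (auto simp: W.p_measurable)
  let ?X = "phase_space A E"
  \<comment> \<open>The isometry from the phase space onto H x H; its inverse applies J to the first
    component.\<close>
  define L where "L z = (the (W.Ah (fst z)), snd z)" for z :: "'h \<times> 'h"
  have X_eq: "z \<in> ?X \<longleftrightarrow> fst z \<in> dom W.Ah" for z
    by (cases z) (simp add: phase_space_def H_space_def Ah_p)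
  have Ah_add: "W.Ah (u + v) = Some (U + V)" if "W.Ah u = Some U" "W.Ah v = Some V" for u v U V
    using that by (simp add: W.Ah_iff E_add Phi_linear W.bounded_p)
  have Ah_scaleC: "W.Ah (a *\<^sub>C u) = Some (a *\<^sub>C U)" if "W.Ah u = Some U" for a u U
    using that by (simp add: W.Ah_iff E_scaleC Phi_linear W.bounded_p)
  have Ah_0: "W.Ah 0 = Some 0"
    using Ah_scaleC[OF W.Ah_J[of 0], of 0] scaleC_of_real[of 0 "0::'h"] scaleC_of_real[of 0 "W.J 0"] by simp
  have "clinear_on ?X L"
    unfolding clinear_on_def L_def
    by (auto simp: X_eq Ah_0 Ah_add Ah_scaleC scaleC_prod_def)
  moreover have "bij_betw L ?X UNIV"
    by (rule bij_betw_byWitness[where f'="\<lambda>z. (W.J (fst z), snd z)"])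
      (auto simp: X_eq L_def W.Ah_J W.J_Ah)
  ultimately interpret R: transported_semigroup ?X "phase_norm A E" L W.T
    by unfold_locales
      (auto simp: phase_norm_def H_norm_def Ah_p L_def norm_prod_def W.contraction_semigroup_T)
  have "is_generator ?X (phase_norm A E) R.S (damped_operator A E f)"
  proof (rule R.is_generator_S)
    fix x y :: "'h \<times> 'h"
    let ?D = "is_dual_sum A (fun_calc A E f) (fst x) (snd x)"
    have dual: "?D h \<longleftrightarrow> (\<forall>n. E (W.B n) h = Phi (\<lambda>r. p r * indicator (W.B n) r) U +
        Phi (\<lambda>r. q r * indicator (W.B n) r) (snd x))" if "W.Ah (fst x) = Some U" for h U
      using W.dual_sum_iff[OF that] by (simp add: A_p[symmetric] F_q)
    have gen: "((\<lambda>t. (1 / t) *\<^sub>R (W.T t (L x) - L x)) \<longlongrightarrow> L y) (at_right 0) \<longleftrightarrow>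
        fst y = snd x \<and> ?D (- snd y)" if xy: "x \<in> ?X" "y \<in> ?X"
    proof -
      obtain U Y where U: "W.Ah (fst x) = Some U" and Y: "W.Ah (fst y) = Some Y"
        using xy by (auto simp: X_eq)
      have neg: "s = - a - b \<longleftrightarrow> - s = a + b" for s a b :: 'h
        using neg_equal_iff_equal[of s "- a - b"] by (simp add: add.commute)
      \<comment> \<open>By \<open>Ah_iff\<close> the left side says that A^(1/2) maps snd x to Y,
        which is also the image of fst y; A^(1/2) is injective by \<open>J_Ah\<close>.\<close>
      have "(\<forall>n. E (W.B n) Y = Phi (\<lambda>r. p r * indicator (W.B n) r) (snd x)) \<longleftrightarrow> fst y = snd x"
        using W.J_Ah Y W.Ah_iff by metis
      moreover have "(\<forall>n. E (W.B n) (snd y) = - Phi (\<lambda>r. p r * indicator (W.B n) r) U -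
          Phi (\<lambda>r. q r * indicator (W.B n) r) (snd x)) \<longleftrightarrow> ?D (- snd y)"
        using E_scaleR[OF W.sets_B, of _ "-1" "snd y"] by (simp add: dual[OF U] neg)
      ultimately show ?thesis
        unfolding W.generator_iff W.P_eq W.G_eq L_def by (auto simp: U Y)
    qed
    have D: "damped_operator A E f x = Some y \<longleftrightarrow>
        x \<in> ?X \<and> snd x \<in> dom W.Ah \<and> fst y = snd x \<and> ?D (- snd y)"
    proof -
      have "(THE h. ?D h) = h" if "x \<in> ?X" "?D h" for h
        using that W.dual_sum_unique[of "fst x"] unfolding A_p[symmetric] F_q[symmetric] X_eq
        by (intro the_equality) auto
      then have "(\<exists>h. ?D h) \<and> snd y = - (THE h. ?D h) \<longleftrightarrow> ?D (- snd y)" if "x \<in> ?X"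
        using that by (metis minus_minus)
      moreover have "damped_operator A E f x = Some y \<longleftrightarrow>
          x \<in> ?X \<and> snd x \<in> dom W.Ah \<and> (\<exists>h. ?D h) \<and> fst y = snd x \<and> snd y = - (THE h. ?D h)"
        by (cases x; cases y) (auto simp: damped_operator_def H_space_def Ah_p)
      ultimately show ?thesis
        by blast
    qed
    show "damped_operator A E f x = Some y \<longleftrightarrow> x \<in> ?X \<and> y \<in> ?X \<and>
        ((\<lambda>t. (1 / t) *\<^sub>R (W.T t (L x) - L x)) \<longlongrightarrow> L y) (at_right 0)"
    \<comment> \<open>The condition v \<in> H^1 in the domain of the operator appears on the
      generator side as y \<in> ?X, because fst y = snd x.\<close>
    proof (cases "x \<in> ?X \<and> y \<in> ?X")
      case True
      then have "fst y \<in> dom W.Ah"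
        by (simp only: X_eq)
      then show ?thesis
        unfolding D gen[OF conjunct1[OF True] conjunct2[OF True]] using True by metis
    next
      case False
      then show ?thesis
        unfolding D X_eq by metis
    qed
  qed
  then show ?thesis
    using R.contraction_semigroup_S by blast
qed

end
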